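(* Assume that for every $n\in\mathbb N$ there are constants $0<m_{2n}\le M_{2n}$ and $M_{2n+1}>0$ such that i) $m_{2n}\|v\|_{U_1}^2\le\|B_1^*(t)v\|_{U_1}^2\le M_{2n}\|v\|_{U_1}^2$ for all $t\in I_{2n}$, $v\in V$; ii) $\|B_2^*(t)v\|_{U_2}^2\le M_{2n+1}\|v\|_W^2$ for all $t\in I_{2n+1}$, $v\in H$; and that $T_{2n+1}\le\tau$ and $T_{2n}\ge\tau$ for all $n\in\mathbb N$. Assume that there is a sequence of times $\{\overline T_n\}_n$ with $T_{2n}>\overline T_n$ for all $n$ such that, for every $n$ and every $T\in(\overline T_n,T_{2n}]$, there is a constant $d_n$, depending on $T$ but independent of the initial data, such that $$E_S(w,t_{2n}+T)\le d_n\int_{t_{2n}}^{t_{2n}+T}\|B_1^*(t)w_t(t)\|_{U_1}^2\,dt$$ for every weak solution $w$ of $$w_{tt}(t)+Aw(t)+B_1(t)B_1^*(t)w_t(t)=0,\ t\in(t_{2n},t_{2n+1}),\qquad w(t_{2n})=w_0^n,\ w_t(t_{2n})=w_1^n,$$ with $(w_0^n,w_1^n)\in V\times H$. Set $\hat d_n=\frac{d_n}{d_n+1}$, where $d_n$ is the constant corresponding to the time $T=T_{2n}$. If $$\sum_{n=0}^\infty M_{2n+1}T_{2n+1}<+\infty\qquad\text{and}\qquad\sum_{n=0}^\infty\ln\hat d_n=-\infty,$$ then the delayed problem is asymptotically stable, that is, every solution $u$ of the delayed problem satisfies $E_S(u,t)\to0$ as $t\to+\infty$.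
   Context: $\mathbb N=\{0,1,2,\dots\}$. $H$ is a real Hilbert space; $A:\mathcal D(A)\to H$ is a positive self-adjoint operator with compact inverse; $V=\mathcal D(A^{1/2})$ with $\|v\|_V=\|A^{1/2}v\|_H$; $V'$ is the dual of $V$ with pivot space $H$. $U_1,U_2$ are real Hilbert spaces identified with their duals, and $V$ is (continuously) embedded into $U_1$. $W$ is a Hilbert space in which $H$ is continuously embedded, with $C>0$ such that $\|v\|_W^2\le C\|v\|_H^2$ for all $v\in H$. $\tau>0$ is fixed. $0=t_0<t_1<t_2<\cdots$ is a sequence, $I_n=[t_n,t_{n+1})$, $T_n=t_{n+1}-t_n$. $B_1(t)\in\mathcal L(U_1,V')$ (possibly unbounded as an operator into $H$) with adjoint $B_1^*(t)\in\mathcal L(V,U_1)$, and $B_2(t)\in\mathcal L(U_2,H)$, satisfy for all $n$: $B_2(t)=0$ for $t\in I_{2n}$, $B_1(t)=0$ for $t\in I_{2n+1}$, $B_2\in C([t_{2n+1},t_{2n+2}];\mathcal L(U_2,H))$, and either $B_1\in C^1([t_{2n},t_{2n+1}];\mathcal L(U_1,H))$, or $B_1(t)=\sqrt{b_1(t)}\,C_n$ on $I_{2n}$ with $C_n\in\mathcal L(U_1,V')$, $b_1\in W^{2,\infty}(t_{2n},t_{2n+1})$ and $b_1(t)>0$ for $t\in I_{2n}$. Delayed problem: $$u_{tt}(t)+Au(t)+B_1(t)B_1^*(t)u_t(t)+B_2(t)B_2^*(t)u_t(t-\tau)=0,\ t>0,\qquad u(0)=u_0\in V,\ u_t(0)=u_1\in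 H.$$ The delay term is $0$ whenever $B_2(t)=0$, in particular on $[0,t_1)\supset[0,\tau)$, so no history data are needed. A solution is a mild solution $u\in C([0,\infty);V)\cap C^1([0,\infty);H)$: on intervals $I_{2n+1}$ the equation holds in $V'$; on compact subintervals $J$ of $I_{2n}$, $u$ is a limit in $C(J;V)\cap C^1(J;H)$ of strong solutions (with $u_t\in V$ and $Au+B_1B_1^*u_t\in H$). Weak solutions of the damped (undelayed) problem on $(t_{2n},t_{2n+1})$ are understood in the same sense, and $B_1^*w_t$ denotes the corresponding $L^2$-in-time limit. Standard energy: $E_S(u,t):=\frac12\left(\|u(t)\|_V^2+\|u_t(t)\|_H^2\right)$. *)

theory Defs
  imports "HOL-Analysis.Analysis"
begin

text \<open>An unbounded operator is a domain \<open>D\<close> together with a map that is only relevant on \<open>D\<close>.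
  Self-adjointness: the graph of the adjoint is the graph of the operator.\<close>

definition self_adjoint_op :: "'h::real_inner set \<Rightarrow> ('h \<Rightarrow> 'h) \<Rightarrow> bool" where
  "self_adjoint_op D A \<longleftrightarrow>
     subspace D \<and> closure D = UNIV \<and>
     (\<forall>x\<in>D. \<forall>y\<in>D. A (x + y) = A x + A y) \<and> (\<forall>c. \<forall>x\<in>D. A (c *\<^sub>R x) = c *\<^sub>R A x) \<and>
     (\<forall>y z. (\<forall>x\<in>D. A x \<bullet> y = x \<bullet> z) \<longleftrightarrow> y \<in> D \<and> z = A y)"

text \<open>Positivity is the non-strict inequality; for an invertible operator it is then strict.\<close>

definition positive_op :: "'h::real_inner set \<Rightarrow> ('h \<Rightarrow> 'h) \<Rightarrow> bool" where
  "positive_op D A \<longleftrightarrow> (\<forall>x\<in>D. 0 \<le> A x \<bullet> x)"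

definition has_compact_inverse :: "'h::real_inner set \<Rightarrow> ('h \<Rightarrow> 'h) \<Rightarrow> bool" where
  "has_compact_inverse D A \<longleftrightarrow>
     bij_betw A D UNIV \<and> (\<forall>S. bounded S \<longrightarrow> compact (closure (inv_into D A ` S)))"

text \<open>\<open>(E, R)\<close> is the square root of \<open>(D, A)\<close>: the positive self-adjoint operator
  with \<open>R\<^sup>2 = A\<close>, equality of domains included.\<close>

definition is_sqrt_op ::
  "'h::real_inner set \<Rightarrow> ('h \<Rightarrow> 'h) \<Rightarrow> 'h set \<Rightarrow> ('h \<Rightarrow> 'h) \<Rightarrow> bool" where
  "is_sqrt_op D A E R \<longleftrightarrow>
     self_adjoint_op E R \<and> positive_op E R \<and>
     D = {x \<in> E. R x \<in> E} \<and> (\<forall>x\<in>D. A x = R (R x))"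

text \<open>\<open>V = D(A\<^sup>1\<^sup>/\<^sup>2)\<close> is represented by a type \<open>'v\<close> with its inclusion \<open>\<iota>\<close> into \<open>H\<close>, and the
  dual \<open>V'\<close> by the normed space of bounded functionals on \<open>'v\<close>.\<close>

definition energy_space ::
  "'h::real_inner set \<Rightarrow> ('h \<Rightarrow> 'h) \<Rightarrow> ('v::real_inner \<Rightarrow>\<^sub>L 'h) \<Rightarrow> bool" where
  "energy_space E R \<iota> \<longleftrightarrow> range (blinfun_apply \<iota>) = E \<and> (\<forall>v. norm v = norm (R (\<iota> v)))"

text \<open>The inclusion of \<open>H\<close> into \<open>V'\<close> with pivot \<open>H\<close>.\<close>

definition pivot :: "('v::real_inner \<Rightarrow>\<^sub>L 'h::real_inner) \<Rightarrow> 'h \<Rightarrow> ('v \<Rightarrow>\<^sub>L real)" where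
  "pivot \<iota> h = blinfun_inner_right h o\<^sub>L \<iota>"

text \<open>The extension of \<open>A\<close> to an operator from \<open>V\<close> to \<open>V'\<close>:
  \<open>\<langle>A v, w\<rangle> = (A\<^sup>1\<^sup>/\<^sup>2 v, A\<^sup>1\<^sup>/\<^sup>2 w)\<close>, which is the inner product of \<open>V\<close>.\<close>

definition A_ext :: "'v::real_inner \<Rightarrow> ('v \<Rightarrow>\<^sub>L real)" where
  "A_ext v = blinfun_inner_right v"

text \<open>The adjoint \<open>V \<rightarrow> U\<close> of \<open>B : U \<rightarrow> V'\<close>, with \<open>U\<close> identified with its dual.\<close>

definition dual_adjoint ::
  "('u::real_inner \<Rightarrow>\<^sub>L ('v::real_normed_vector \<Rightarrow>\<^sub>L real)) \<Rightarrow> 'v \<Rightarrow> 'u" where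
  "dual_adjoint B v = (THE y. \<forall>x. x \<bullet> y = B x v)"

definition L_infinity :: "real \<Rightarrow> real \<Rightarrow> (real \<Rightarrow> real) \<Rightarrow> bool" where
  "L_infinity a b f \<longleftrightarrow>
     f \<in> borel_measurable (lebesgue_on {a<..<b}) \<and>
     (\<exists>C. AE x in lebesgue_on {a<..<b}. \<bar>f x\<bar> \<le> C)"

definition test_fun :: "real \<Rightarrow> real \<Rightarrow> (real \<Rightarrow> real) \<Rightarrow> bool" where
  "test_fun a b \<phi> \<longleftrightarrow>
     (\<forall>k x. (deriv ^^ k) \<phi> differentiable (at x)) \<and>
     (\<exists>c d. a < c \<and> d < b \<and> (\<forall>x. x \<notin> {c..d} \<longrightarrow> \<phi> x = 0))"

definition weak_deriv :: "real \<Rightarrow> real \<Rightarrow> (real \<Rightarrow> real) \<Rightarrow> (real \<Rightarrow> real) \<Rightarrow> bool" where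
  "weak_deriv a b f g \<longleftrightarrow>
     (\<forall>\<phi>. test_fun a b \<phi> \<longrightarrow>
        (LINT x:{a<..<b}|lebesgue. f x * deriv \<phi> x) = - (LINT x:{a<..<b}|lebesgue. g x * \<phi> x))"

definition W2_infinity :: "real \<Rightarrow> real \<Rightarrow> (real \<Rightarrow> real) \<Rightarrow> bool" where
  "W2_infinity a b f \<longleftrightarrow>
     (\<exists>f' f''. L_infinity a b f \<and> L_infinity a b f' \<and> L_infinity a b f'' \<and>
        weak_deriv a b f f' \<and> weak_deriv a b f' f'')"

definition slot :: "(nat \<Rightarrow> real) \<Rightarrow> nat \<Rightarrow> real set" where
  "slot t n = {t n..<t (n + 1)}"

definition len :: "(nat \<Rightarrow> real) \<Rightarrow> nat \<Rightarrow> real" where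
  "len t n = t (n + 1) - t n"

text \<open>Only the values on \<open>[a, b)\<close> are constrained: the operators may jump at \<open>b\<close> (where they
  are switched off), so regularity on \<open>[a, b]\<close> is that of an extension to the closed interval.\<close>

definition C0_closure :: "real \<Rightarrow> real \<Rightarrow> (real \<Rightarrow> 'a::real_normed_vector) \<Rightarrow> bool" where
  "C0_closure a b F \<longleftrightarrow> (\<exists>G. continuous_on {a..b} G \<and> (\<forall>s\<in>{a..<b}. F s = G s))"

text \<open>\<open>B \<in> C\<^sup>1([a, b]; L(U, H))\<close>, where \<open>L(U, H)\<close> is included in \<open>L(U, V')\<close> through \<open>pivot\<close>.\<close>

definition C1_into_H :: "('v::real_inner \<Rightarrow>\<^sub>L 'h::real_inner) \<Rightarrow> real \<Rightarrow> real \<Rightarrow>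
    (real \<Rightarrow> ('u::real_inner \<Rightarrow>\<^sub>L ('v \<Rightarrow>\<^sub>L real))) \<Rightarrow> bool" where
  "C1_into_H \<iota> a b B \<longleftrightarrow>
     (\<exists>(G :: real \<Rightarrow> ('u \<Rightarrow>\<^sub>L 'h)) G'.
        (\<forall>s\<in>{a..b}. (G has_vector_derivative G' s) (at s within {a..b})) \<and>
        continuous_on {a..b} G' \<and>
        (\<forall>s\<in>{a..<b}. \<forall>x. blinfun_apply (B s) x = pivot \<iota> (blinfun_apply (G s) x)))"

text \<open>\<open>B(s) = \<surd>b(s) C\<close> with \<open>b > 0\<close> on \<open>[a, b)\<close>; as \<open>b\<close> is evaluated pointwise, it is
  the continuous representative of its class.\<close>

definition sqrt_factor_form :: "real \<Rightarrow> real \<Rightarrow>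
    (real \<Rightarrow> ('u::real_inner \<Rightarrow>\<^sub>L ('v::real_inner \<Rightarrow>\<^sub>L real))) \<Rightarrow> bool" where
  "sqrt_factor_form a b B \<longleftrightarrow>
     (\<exists>(\<beta> :: real \<Rightarrow> real) (C :: 'u \<Rightarrow>\<^sub>L ('v \<Rightarrow>\<^sub>L real)).
        W2_infinity a b \<beta> \<and> continuous_on {a..<b} \<beta> \<and> (\<forall>s\<in>{a..<b}. 0 < \<beta> s) \<and>
        (\<forall>s\<in>{a..<b}. B s = sqrt (\<beta> s) *\<^sub>R C))"

text \<open>A trajectory is a pair of a \<open>V\<close>-valued function and its time derivative.\<close>

definition E_S :: "(real \<Rightarrow> 'v::real_normed_vector) \<Rightarrow> (real \<Rightarrow> 'h::real_normed_vector) \<Rightarrow>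
    real \<Rightarrow> real" where
  "E_S u ut t = ((norm (u t))\<^sup>2 + (norm (ut t))\<^sup>2) / 2"

text \<open>\<open>u \<in> C(J; V) \<inter> C\<^sup>1(J; H)\<close> with \<open>u\<^sub>t = ut\<close>.\<close>

definition energy_class :: "('v::real_inner \<Rightarrow>\<^sub>L 'h::real_inner) \<Rightarrow> real set \<Rightarrow>
    (real \<Rightarrow> 'v) \<Rightarrow> (real \<Rightarrow> 'h) \<Rightarrow> bool" where
  "energy_class \<iota> J u ut \<longleftrightarrow>
     continuous_on J u \<and> continuous_on J ut \<and>
     (\<forall>t\<in>J. ((\<lambda>s. \<iota> (u s)) has_vector_derivative ut t) (at t within J))"

text \<open>Strong solutions of \<open>w\<^sub>t\<^sub>t + A w + B B\<^sup>* w\<^sub>t = 0\<close> on \<open>J\<close>: \<open>w \<in> C\<^sup>1(J; V) \<inter> C\<^sup>2(J; H)\<close>. The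
  equation says in particular that the element \<open>A w + B B\<^sup>* w\<^sub>t\<close> of \<open>V'\<close> lies in \<open>H\<close>.\<close>

definition strong_solution :: "('v::real_inner \<Rightarrow>\<^sub>L 'h::real_inner) \<Rightarrow>
    (real \<Rightarrow> ('u::real_inner \<Rightarrow>\<^sub>L ('v \<Rightarrow>\<^sub>L real))) \<Rightarrow> real set \<Rightarrow>
    (real \<Rightarrow> 'v) \<Rightarrow> (real \<Rightarrow> 'v) \<Rightarrow> bool" where
  "strong_solution \<iota> B J w wt \<longleftrightarrow>
     (\<forall>t\<in>J. (w has_vector_derivative wt t) (at t within J)) \<and> continuous_on J wt \<and>
     (\<exists>wtt :: real \<Rightarrow> 'h.
        (\<forall>t\<in>J. ((\<lambda>s. \<iota> (wt s)) has_vector_derivative wtt t) (at t within J)) \<and>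
        continuous_on J wtt \<and>
        (\<forall>t\<in>J. pivot \<iota> (wtt t) + A_ext (w t) + B t (dual_adjoint (B t) (wt t)) = 0))"

text \<open>Strong solutions converging to \<open>w\<close> in \<open>C(J; V) \<inter> C\<^sup>1(J; H)\<close>.\<close>

definition strong_approximation :: "('v::real_inner \<Rightarrow>\<^sub>L 'h::real_inner) \<Rightarrow>
    (real \<Rightarrow> ('u::real_inner \<Rightarrow>\<^sub>L ('v \<Rightarrow>\<^sub>L real))) \<Rightarrow> real set \<Rightarrow>
    (nat \<Rightarrow> real \<Rightarrow> 'v) \<Rightarrow> (nat \<Rightarrow> real \<Rightarrow> 'v) \<Rightarrow> (real \<Rightarrow> 'v) \<Rightarrow> (real \<Rightarrow> 'h) \<Rightarrow> bool" where
  "strong_approximation \<iota> B J wk wtk w wt \<longleftrightarrow>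
     (\<forall>k. strong_solution \<iota> B J (wk k) (wtk k)) \<and>
     uniform_limit J wk w sequentially \<and>
     uniform_limit J (\<lambda>k t. \<iota> (wtk k t)) wt sequentially"

definition limit_of_strong :: "('v::real_inner \<Rightarrow>\<^sub>L 'h::real_inner) \<Rightarrow>
    (real \<Rightarrow> ('u::real_inner \<Rightarrow>\<^sub>L ('v \<Rightarrow>\<^sub>L real))) \<Rightarrow> real set \<Rightarrow>
    (real \<Rightarrow> 'v) \<Rightarrow> (real \<Rightarrow> 'h) \<Rightarrow> bool" where
  "limit_of_strong \<iota> B I w wt \<longleftrightarrow>
     (\<forall>a b. a < b \<and> {a..b} \<subseteq> I \<longrightarrow>
        (\<exists>wk wtk. strong_approximation \<iota> B {a..b} wk wtk w wt))"

text \<open>\<open>g\<close> is \<open>B\<^sup>* w\<^sub>t\<close> on \<open>I\<close>: since \<open>w\<^sub>t\<close> is only \<open>H\<close>-valued, this is the limit in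
  \<open>L\<^sup>2\<close> of compact subintervals of the functions \<open>B\<^sup>* w\<^sub>k\<^sub>,\<^sub>t\<close> of approximating strong solutions;
  it determines \<open>g\<close> almost everywhere.\<close>

definition damping_trace :: "('v::real_inner \<Rightarrow>\<^sub>L 'h::real_inner) \<Rightarrow>
    (real \<Rightarrow> ('u::real_inner \<Rightarrow>\<^sub>L ('v \<Rightarrow>\<^sub>L real))) \<Rightarrow> real set \<Rightarrow>
    (real \<Rightarrow> 'v) \<Rightarrow> (real \<Rightarrow> 'h) \<Rightarrow> (real \<Rightarrow> 'u) \<Rightarrow> bool" where
  "damping_trace \<iota> B I w wt g \<longleftrightarrow>
     (\<forall>a b. a < b \<and> {a..b} \<subseteq> I \<longrightarrow>
        (\<exists>wk wtk. strong_approximation \<iota> B {a..b} wk wtk w wt \<and>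
           (\<forall>k. set_integrable lebesgue {a..b}
                  (\<lambda>t. (norm (dual_adjoint (B t) (wtk k t) - g t))\<^sup>2)) \<and>
           (\<lambda>k. LINT t:{a..b}|lebesgue. (norm (dual_adjoint (B t) (wtk k t) - g t))\<^sup>2)
             \<longlonglongrightarrow> 0))"

text \<open>Weak solutions of the undelayed problem on \<open>(a, b)\<close> with data \<open>(w0, w1)\<close> at \<open>a\<close>; the
  trajectory is continuous up to \<open>b\<close>, so that its energy at \<open>b\<close> makes sense.\<close>

definition weak_solution :: "('v::real_inner \<Rightarrow>\<^sub>L 'h::real_inner) \<Rightarrow>
    (real \<Rightarrow> ('u::real_inner \<Rightarrow>\<^sub>L ('v \<Rightarrow>\<^sub>L real))) \<Rightarrow> real \<Rightarrow> real \<Rightarrow> 'v \<Rightarrow> 'h \<Rightarrow>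
    (real \<Rightarrow> 'v) \<Rightarrow> (real \<Rightarrow> 'h) \<Rightarrow> bool" where
  "weak_solution \<iota> B a b w0 w1 w wt \<longleftrightarrow>
     energy_class \<iota> {a..b} w wt \<and> w a = w0 \<and> wt a = w1 \<and> limit_of_strong \<iota> B {a..<b} w wt"

text \<open>Mild solutions of the delayed problem. The damping \<open>B1\<close> vanishes on the odd intervals and
  the delay term on the even ones, so each kind of interval only sees its own term.\<close>

definition delayed_solution :: "('v::real_inner \<Rightarrow>\<^sub>L 'h::real_inner) \<Rightarrow>
    (real \<Rightarrow> ('u1::real_inner \<Rightarrow>\<^sub>L ('v \<Rightarrow>\<^sub>L real))) \<Rightarrow> (real \<Rightarrow> ('u2::real_inner \<Rightarrow>\<^sub>L 'h)) \<Rightarrow>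
    real \<Rightarrow> (nat \<Rightarrow> real) \<Rightarrow> 'v \<Rightarrow> 'h \<Rightarrow> (real \<Rightarrow> 'v) \<Rightarrow> (real \<Rightarrow> 'h) \<Rightarrow> bool" where
  "delayed_solution \<iota> B1 B2 \<tau> t u0 u1 u ut \<longleftrightarrow>
     energy_class \<iota> {0..} u ut \<and> u 0 = u0 \<and> ut 0 = u1 \<and>
     (\<forall>n. limit_of_strong \<iota> B1 (slot t (2*n)) u ut) \<and>
     (\<forall>n. \<forall>s\<in>slot t (2*n+1).
        ((\<lambda>r. pivot \<iota> (ut r)) has_vector_derivative
           - (A_ext (u s) + pivot \<iota> (B2 s (adjoint (blinfun_apply (B2 s)) (ut (s - \<tau>))))))
        (at s within slot t (2*n+1)))"

end

theory Submission
  imports Defs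
begin

text \<open>On an even interval the energy identity gives \<open>\<integral> \<parallel>B\<^sub>1\<^sup>* u\<^sub>t\<parallel>\<^sup>2 \<le> E(t\<^sub>2\<^sub>n) - E(t\<^sub>2\<^sub>n\<^sub>+\<^sub>1)\<close>, so
  observability yields \<open>E(t\<^sub>2\<^sub>n\<^sub>+\<^sub>1) \<le> d\<^sub>n / (d\<^sub>n + 1) E(t\<^sub>2\<^sub>n)\<close>. On the following odd interval the delay
  term looks back only into the even one, where \<open>E \<le> E(t\<^sub>2\<^sub>n)\<close>; with \<open>x\<^sub>n = C M\<^sub>2\<^sub>n\<^sub>+\<^sub>1 T\<^sub>2\<^sub>n\<^sub>+\<^sub>1\<close> a Gronwall
  estimate gives \<open>E(t\<^sub>2\<^sub>n\<^sub>+\<^sub>2) + E(t\<^sub>2\<^sub>n) \<le> exp x\<^sub>n (E(t\<^sub>2\<^sub>n\<^sub>+\<^sub>1) + E(t\<^sub>2\<^sub>n))\<close>. Hence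
  \<open>E(t\<^sub>2\<^sub>n\<^sub>+\<^sub>2) \<le> exp (2 x\<^sub>n - 1 / (d\<^sub>n + 1)) E(t\<^sub>2\<^sub>n)\<close>, where \<open>\<Sum> x\<^sub>n\<close> converges and
  \<open>\<Sum> 1 / (d\<^sub>n + 1)\<close> diverges.\<close>

section \<open>Riesz representation, adjoints and antiderivatives\<close>

text \<open>The representing vector minimises \<open>\<lambda>x. \<parallel>x\<parallel>\<^sup>2 / 2 - f x\<close>; minimising sequences are Cauchy by
  the parallelogram law.\<close>

theorem riesz_representation:
  fixes f :: "'a::{real_inner,complete_space} \<Rightarrow>\<^sub>L real"
  obtains y where "\<And>x. f x = x \<bullet> y"
proof -
  define q where "q x = (norm x)\<^sup>2 / 2 - f x" for x
  define I where "I = Inf (range q)"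
  have "q x \<ge> - (norm f)\<^sup>2 / 2" for x
  proof -
    have "f x \<le> norm f * norm x"
      using norm_blinfun[of f x] by simp
    moreover have "0 \<le> (norm x - norm f)\<^sup>2"
      by simp
    ultimately show ?thesis
      unfolding q_def by (simp add: power2_diff algebra_simps)
  qed
  then have bdd: "bdd_below (range q)"
    by (auto simp: bdd_below_def)
  have I_le: "I \<le> q x" for x
    unfolding I_def by (rule cInf_lower[OF _ bdd]) simp
  have "\<exists>x. q x < I + 1 / real (Suc n)" for n
    using cInf_lessD[of "range q" "I + 1 / real (Suc n)"] by (auto simp: I_def)
  then obtain X where X: "\<And>n. q (X n) < I + 1 / real (Suc n)"
    by metis
  have par: "(norm (x - y))\<^sup>2 / 4 = q x + q y - 2 * q ((1/2) *\<^sub>R (x + y))" for x y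
    by (simp add: q_def blinfun.scaleR_right blinfun.add_right power2_norm_eq_inner inner_add_left
        inner_add_right inner_diff_left inner_diff_right inner_commute field_simps)
  have "Cauchy X"
  proof (rule metric_CauchyI)
    fix e :: real
    assume "e > 0"
    \<comment> \<open>If \<open>q\<close> is below \<open>I\<close> plus e^2/8 at both points, the
      identity \<open>par\<close> bounds their squared distance by 4 times e^2/4.\<close>
    then obtain N where N: "1 / real (Suc N) < e\<^sup>2 / 8"
      using nat_approx_posE[of "e\<^sup>2 / 8"] by (metis zero_less_divide_iff zero_less_numeral zero_less_power)
    have "dist (X i) (X j) < e" if "i \<ge> N" "j \<ge> N" for i j
    proof -
      have small: "q (X k) < I + e\<^sup>2 / 8" if "k \<ge> N" for k
      proof -
        have "1 / real (Suc k) \<le> 1 / real (Suc N)"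
          using that by (simp add: frac_le)
        then show ?thesis
          using X[of k] N by linarith
      qed
      have "(norm (X i - X j))\<^sup>2 < e\<^sup>2"
        using par[of "X i" "X j"] small[OF that(1)] small[OF that(2)]
          I_le[of "(1/2) *\<^sub>R (X i + X j)"] by linarith
      then show ?thesis
        using \<open>e > 0\<close> by (simp add: dist_norm power2_less_imp_less)
    qed
    then show "\<exists>N. \<forall>i\<ge>N. \<forall>j\<ge>N. dist (X i) (X j) < e"
      by blast
  qed
  then obtain y where y: "X \<longlonglongrightarrow> y"
    using Cauchy_convergent convergent_def by blast
  have "(\<lambda>n. q (X n)) \<longlonglongrightarrow> q y"
    unfolding q_def by (intro tendsto_intros y) auto
  moreover have "(\<lambda>n. I + 1 / real (Suc n)) \<longlonglongrightarrow> I + 0"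
    using LIMSEQ_inverse_real_of_nat by (intro tendsto_intros) (simp add: inverse_eq_divide)
  ultimately have "q y \<le> I + 0"
    by (rule LIMSEQ_le) (use X less_imp_le in blast)
  then have qy: "q y \<le> q x" for x
    using I_le[of x] by simp
  have "f x = x \<bullet> y" for x
  proof (cases "x = 0")
    case False
    define c where "c = x \<bullet> y - f x"
    \<comment> \<open>This \<open>s\<close> minimises the quadratic polynomial by which
      \<open>q\<close> changes from \<open>y\<close> along \<open>x\<close>.\<close>
    define s where "s = - c / (norm x)\<^sup>2"
    have "q (y + s *\<^sub>R x) - q y = s * c + s\<^sup>2 * (norm x)\<^sup>2 / 2"
      unfolding q_def c_def power2_norm_eq_inner
      by (simp add: blinfun.scaleR_right blinfun.add_right inner_add_left inner_add_right
          inner_commute algebra_simps power2_eq_square)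
    also have "\<dots> = - c\<^sup>2 / (2 * (norm x)\<^sup>2)"
      unfolding s_def using False by (simp add: field_simps power2_eq_square)
    finally have "c\<^sup>2 / (2 * (norm x)\<^sup>2) \<le> 0"
      using qy[of "y + s *\<^sub>R x"] by simp
    then have "c = 0"
      using False by (simp add: divide_le_0_iff zero_less_mult_iff)
    then show ?thesis
      by (simp add: c_def)
  qed (simp add: blinfun.zero_right)
  then show ?thesis
    by (rule that)
qed

text \<open>Riesz representation supplies the vector described by \<open>THE\<close> in
  \<open>dual_adjoint\<close>, and nondegeneracy of the inner product makes it unique. Later facts
  about \<open>dual_adjoint\<close> rest on this identity.\<close>

lemma inner_dual_adjoint:
  fixes B :: "'u::{real_inner,complete_space} \<Rightarrow>\<^sub>L ('v::real_normed_vector \<Rightarrow>\<^sub>L real)"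
  shows "x \<bullet> dual_adjoint B v = B x v"
proof -
  have bl: "bounded_linear (\<lambda>x. B x v)"
    by (intro bounded_linear_compose[OF blinfun.bounded_linear_left] blinfun.bounded_linear_right)
  obtain y where y: "\<And>x. Blinfun (\<lambda>x. B x v) x = x \<bullet> y"
    using riesz_representation[of "Blinfun (\<lambda>x. B x v)"] by blast
  then have "\<forall>x. x \<bullet> y = B x v"
    using bl by (simp add: bounded_linear_Blinfun_apply)
  moreover have "z = y" if "\<forall>x. x \<bullet> z = B x v" for z
    using that \<open>\<forall>x. x \<bullet> y = B x v\<close> by (intro vector_eq_ldot[THEN iffD1]) simp
  ultimately have "\<forall>x. x \<bullet> dual_adjoint B v = B x v"
    unfolding dual_adjoint_def by (rule theI)
  then show ?thesis ..
qed

lemma dual_adjoint_diff: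
  fixes B :: "'u::{real_inner,complete_space} \<Rightarrow>\<^sub>L ('v::real_normed_vector \<Rightarrow>\<^sub>L real)"
  shows "dual_adjoint B (v - w) = dual_adjoint B v - dual_adjoint B w"
  by (rule vector_eq_ldot[THEN iffD1])
    (simp add: inner_diff_right inner_dual_adjoint blinfun.diff_right)

text \<open>\<open>adjoint\<close> is a choice of a whole map, so the Riesz vectors found for each
  \<open>y\<close> are first collected into one function before the choice is resolved.\<close>

lemma inner_adjoint_blinfun:
  fixes B :: "'u::{real_inner,complete_space} \<Rightarrow>\<^sub>L 'h::real_inner"
  shows "x \<bullet> adjoint (blinfun_apply B) y = B x \<bullet> y"
proof -
  have "\<exists>z. \<forall>x. B x \<bullet> y = x \<bullet> z" for y
  proof -
    have "bounded_linear (\<lambda>x. B x \<bullet> y)"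
      by (intro bounded_linear_inner_left_comp blinfun.bounded_linear_right)
    then show ?thesis
      using riesz_representation[of "Blinfun (\<lambda>x. B x \<bullet> y)"]
      by (metis bounded_linear_Blinfun_apply)
  qed
  then have "\<exists>f'. \<forall>x y. B x \<bullet> y = x \<bullet> f' y"
    by metis
  then have "\<forall>x y. B x \<bullet> y = x \<bullet> adjoint (blinfun_apply B) y"
    unfolding adjoint_def by (rule someI_ex)
  then show ?thesis
    by simp
qed

text \<open>Cauchy-Schwarz gives the upper bound and evaluation at \<open>x\<close> itself the lower
  one. The isometry lets derivatives in the dual be pulled back.\<close>

lemma norm_blinfun_inner_right: "norm (blinfun_inner_right (x::'a::real_inner)) = norm x"
proof (rule antisym)
  show "norm (blinfun_inner_right x) \<le> norm x"
    by (rule norm_blinfun_bound) (simp_all add: Cauchy_Schwarz_ineq2)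
  show "norm x \<le> norm (blinfun_inner_right x)"
  proof (cases "x = 0")
    case False
    have "(norm x)\<^sup>2 \<le> norm (blinfun_inner_right x) * norm x"
      using norm_blinfun[of "blinfun_inner_right x" x] by (simp add: power2_norm_eq_inner)
    then show ?thesis
      using False by (simp add: power2_eq_square)
  qed simp
qed

text \<open>The sort \<open>{real_inner, complete_space}\<close> does not entail class \<open>banach\<close>, so the integral is
  taken in the dual space and pulled back along the Riesz isometry.\<close>

lemma continuous_antiderivative:
  fixes f :: "real \<Rightarrow> 'a::{real_inner,complete_space}"
  assumes "continuous_on {a..b} f"
  obtains F where "\<And>s. s \<in> {a..b} \<Longrightarrow> (F has_vector_derivative f s) (at s within {a..b})"
proof -
  define g where "g s = blinfun_inner_right (f s)" for s
  have "\<exists>y. blinfun_inner_right y = \<phi>" for \<phi> :: "'a \<Rightarrow>\<^sub>L real"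
  proof -
    obtain y where "\<And>x. \<phi> x = x \<bullet> y"
      using riesz_representation[of \<phi>] by blast
    then have "blinfun_inner_right y = \<phi>"
      by (intro blinfun_eqI) (simp add: inner_commute)
    then show ?thesis ..
  qed
  then have "\<forall>s. \<exists>y. blinfun_inner_right y = integral {a..s} g"
    by blast
  then obtain F where F: "\<And>s. blinfun_inner_right (F s) = integral {a..s} g"
    using choice[of "\<lambda>s y. blinfun_inner_right y = integral {a..s} g"] by blast
  have lin: "bounded_linear (blinfun_inner_right :: 'a \<Rightarrow> _)"
    by (rule bounded_linear_blinfun_inner_right)
  have "continuous_on {a..b} g"
    unfolding g_def using lin assms by (rule bounded_linear.continuous_on)
  have "(F has_vector_derivative f s) (at s within {a..b})" if "s \<in> {a..b}" for s
  proof -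
    have "((\<lambda>s. blinfun_inner_right (F s)) has_vector_derivative blinfun_inner_right (f s))
        (at s within {a..b})"
      unfolding F using integral_has_vector_derivative[OF \<open>continuous_on {a..b} g\<close> that]
      by (simp add: g_def)
    \<comment> \<open>Differentiability is a limit of norms of remainders, which the linear isometry
      leaves unchanged.\<close>
    then show ?thesis
      unfolding has_vector_derivative_def has_derivative_iff_norm
      by (simp add: norm_blinfun_inner_right bounded_linear_scaleR_left
          flip: linear_diff[OF bounded_linear.linear[OF lin]]
            linear_scale[OF bounded_linear.linear[OF lin]])
  qed
  then show ?thesis
    by (rule that)
qed

section \<open>Strong solutions and their energy identity\<close>

lemma strong_solution_subset:
  assumes "strong_solution \<iota> B J w wt" "K \<subseteq> J"
  shows "strong_solution \<iota> B K w wt"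
  using assms unfolding strong_solution_def
  by (meson continuous_on_subset has_vector_derivative_within_subset subsetD)

text \<open>The equation is linear. For two approximants of the same trajectory this makes the
  energy identity control the distance of their damping terms.\<close>

lemma strong_solution_diff:
  fixes B :: "real \<Rightarrow> ('u::{real_inner,complete_space} \<Rightarrow>\<^sub>L ('v::real_inner \<Rightarrow>\<^sub>L real))"
  assumes "strong_solution \<iota> B J w wt" "strong_solution \<iota> B J v vt"
  shows "strong_solution \<iota> B J (\<lambda>s. w s - v s) (\<lambda>s. wt s - vt s)"
proof -
  obtain wtt where w: "\<And>t. t\<in>J \<Longrightarrow> (w has_vector_derivative wt t) (at t within J)" "continuous_on J wt"
    "\<And>t. t\<in>J \<Longrightarrow> ((\<lambda>s. \<iota> (wt s)) has_vector_derivative wtt t) (at t within J)"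
    "continuous_on J wtt"
    "\<And>t. t\<in>J \<Longrightarrow> pivot \<iota> (wtt t) + A_ext (w t) + B t (dual_adjoint (B t) (wt t)) = 0"
    using assms(1) unfolding strong_solution_def by blast
  obtain vtt where v: "\<And>t. t\<in>J \<Longrightarrow> (v has_vector_derivative vt t) (at t within J)" "continuous_on J vt"
    "\<And>t. t\<in>J \<Longrightarrow> ((\<lambda>s. \<iota> (vt s)) has_vector_derivative vtt t) (at t within J)"
    "continuous_on J vtt"
    "\<And>t. t\<in>J \<Longrightarrow> pivot \<iota> (vtt t) + A_ext (v t) + B t (dual_adjoint (B t) (vt t)) = 0"
    using assms(2) unfolding strong_solution_def by blast
  have eq: "pivot \<iota> (wtt t - vtt t) + A_ext (w t - v t) + B t (dual_adjoint (B t) (wt t - vt t)) = 0"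
    if "t \<in> J" for t
  proof -
    have "pivot \<iota> (wtt t - vtt t) + A_ext (w t - v t) + B t (dual_adjoint (B t) (wt t - vt t)) =
      (pivot \<iota> (wtt t) + A_ext (w t) + B t (dual_adjoint (B t) (wt t))) -
      (pivot \<iota> (vtt t) + A_ext (v t) + B t (dual_adjoint (B t) (vt t)))"
      by (rule blinfun_eqI)
        (simp add: pivot_def A_ext_def dual_adjoint_diff blinfun.diff_right blinfun.diff_left
          blinfun.add_left inner_diff_left)
    then show ?thesis
      using w(5)[OF that] v(5)[OF that] by simp
  qed
  show ?thesis
    unfolding strong_solution_def
  proof (intro conjI exI[of _ "\<lambda>s. wtt s - vtt s"] ballI)
    show "((\<lambda>s. \<iota> (wt s - vt s)) has_vector_derivative wtt t - vtt t) (at t within J)"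
      if "t \<in> J" for t
      using has_vector_derivative_diff[OF w(3)[OF that] v(3)[OF that]]
      by (simp add: blinfun.diff_right)
  qed (auto intro!: eq has_vector_derivative_diff continuous_on_diff w v)
qed

lemma E_S_has_vector_derivative:
  fixes u :: "real \<Rightarrow> 'v::real_inner" and v :: "real \<Rightarrow> 'h::real_inner"
  assumes "(u has_vector_derivative u') (at s within S)"
    and "(v has_vector_derivative v') (at s within S)"
  shows "(E_S u v has_vector_derivative (u s \<bullet> u' + v s \<bullet> v')) (at s within S)"
proof -
  have "((\<lambda>s. (u s \<bullet> u s + v s \<bullet> v s) * (1 / 2)) has_vector_derivative
      (u s \<bullet> u' + u' \<bullet> u s + (v s \<bullet> v' + v' \<bullet> v s)) * (1 / 2)) (at s within S)"
    by (intro has_vector_derivative_mult_left has_vector_derivative_add assms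
        bounded_bilinear.has_vector_derivative[OF bounded_bilinear_inner])
  moreover have "(\<lambda>s. (u s \<bullet> u s + v s \<bullet> v s) * (1 / 2)) = E_S u v"
    by (simp add: fun_eq_iff E_S_def power2_norm_eq_inner)
  ultimately show ?thesis
    by (simp add: inner_commute add_divide_distrib)
qed

text \<open>Testing the equation, an identity in the dual of V, with \<open>wt s\<close> turns its
  first two terms into the derivative of the energy and the damping term into the integrand. The
  fundamental theorem of calculus gives integrability along with the value.\<close>

lemma strong_solution_energy:
  fixes B :: "real \<Rightarrow> ('u::{real_inner,complete_space} \<Rightarrow>\<^sub>L ('v::real_inner \<Rightarrow>\<^sub>L real))"
  assumes sol: "strong_solution \<iota> B {a..b} w wt" and "a \<le> b"
  shows "((\<lambda>s. (norm (dual_adjoint (B s) (wt s)))\<^sup>2) has_integral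
    (E_S w (\<lambda>s. \<iota> (wt s)) a - E_S w (\<lambda>s. \<iota> (wt s)) b)) {a..b}"
proof -
  obtain wtt where w: "\<And>t. t\<in>{a..b} \<Longrightarrow> (w has_vector_derivative wt t) (at t within {a..b})"
    "\<And>t. t\<in>{a..b} \<Longrightarrow> ((\<lambda>s. \<iota> (wt s)) has_vector_derivative wtt t) (at t within {a..b})"
    "\<And>t. t\<in>{a..b} \<Longrightarrow> pivot \<iota> (wtt t) + A_ext (w t) + B t (dual_adjoint (B t) (wt t)) = 0"
    using sol unfolding strong_solution_def by blast
  have "((\<lambda>s. (norm (dual_adjoint (B s) (wt s)))\<^sup>2) has_integral
    (- E_S w (\<lambda>s. \<iota> (wt s)) b) - (- E_S w (\<lambda>s. \<iota> (wt s)) a)) {a..b}"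
  proof (rule fundamental_theorem_of_calculus[OF \<open>a \<le> b\<close>])
    fix s assume s: "s \<in> {a..b}"
    have "(pivot \<iota> (wtt s) + A_ext (w s) + B s (dual_adjoint (B s) (wt s))) (wt s) = 0"
      using w(3)[OF s] by simp
    then have eq: "wtt s \<bullet> \<iota> (wt s) + w s \<bullet> wt s + (norm (dual_adjoint (B s) (wt s)))\<^sup>2 = 0"
      by (simp add: pivot_def A_ext_def blinfun.add_left power2_norm_eq_inner inner_dual_adjoint)
    have "((\<lambda>s. - E_S w (\<lambda>s. \<iota> (wt s)) s) has_vector_derivative
        - (w s \<bullet> wt s + \<iota> (wt s) \<bullet> wtt s)) (at s within {a..b})"
      using E_S_has_vector_derivative[OF w(1)[OF s] w(2)[OF s]]
      by (rule has_vector_derivative_minus)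
    moreover have "- (w s \<bullet> wt s + \<iota> (wt s) \<bullet> wtt s) = (norm (dual_adjoint (B s) (wt s)))\<^sup>2"
      using eq by (simp add: inner_commute)
    ultimately show "((\<lambda>s. - E_S w (\<lambda>s. \<iota> (wt s)) s) has_vector_derivative
        (norm (dual_adjoint (B s) (wt s)))\<^sup>2) (at s within {a..b})"
      by simp
  qed
  then show ?thesis
    by simp
qed

section \<open>Construction of the damping trace by a diagonal limit\<close>

text \<open>The geometric tail \<open>c * q ^ j / (1 - q)\<close> dominates all later distances;
  keeping the remaining tail on the left-hand side makes the induction close.\<close>

lemma Cauchy_geometric_steps:
  fixes F :: "nat \<Rightarrow> 'a::metric_space"
  assumes step: "\<And>j. i \<le> j \<Longrightarrow> dist (F j) (F (Suc j)) \<le> c * q ^ j" and q: "0 \<le> q" "q < 1"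
  shows "Cauchy F"
proof -
  have bound: "dist (F j) (F (j + n)) + c * q ^ (j + n) / (1 - q) \<le> c * q ^ j / (1 - q)"
    if "i \<le> j" for j n
  proof (induction n)
    case (Suc n)
    have "c * q ^ (j + n) / (1 - q) = c * q ^ (j + n) + c * q ^ (j + Suc n) / (1 - q)"
      using q by (simp add: field_simps)
    moreover have "dist (F (j + n)) (F (Suc (j + n))) \<le> c * q ^ (j + n)"
      using that by (intro step) simp
    ultimately show ?case
      using Suc.IH dist_triangle[of "F j" "F (Suc (j + n))" "F (j + n)"] by simp
  qed simp
  \<comment> \<open>\<open>c\<close> comes without a sign; nonnegativity of a distance supplies it
    at the index \<open>i\<close> and hence beyond.\<close>
  have "0 \<le> c * q ^ i"
    using step[of i] zero_le_dist[of "F i" "F (Suc i)"] by linarith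
  then have c: "0 \<le> c * q ^ (i + n)" for n
    using q by (simp add: power_add mult.assoc[symmetric])
  have "(\<lambda>j. c * q ^ j / (1 - q)) \<longlonglongrightarrow> c * 0 / (1 - q)"
    using q by (intro tendsto_intros LIMSEQ_realpow_zero) auto
  then have lim: "(\<lambda>j. c * q ^ j / (1 - q)) \<longlonglongrightarrow> 0"
    by simp
  show ?thesis
    unfolding Cauchy_altdef2
  proof (intro allI impI)
    fix e :: real
    assume "e > 0"
    then have "\<forall>\<^sub>F j in sequentially. c * q ^ j / (1 - q) < e"
      using lim by (simp add: order_tendstoD)
    then obtain N where N: "c * q ^ (N + i) / (1 - q) < e"
      unfolding eventually_sequentially by (meson le_add1)
    have "dist (F k) (F (N + i)) < e" if "N + i \<le> k" for k
    proof -
      obtain n where k: "k = N + i + n"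
        using \<open>N + i \<le> k\<close> le_Suc_ex by blast
      have "0 \<le> c * q ^ k / (1 - q)"
        using c[of "N + n"] q by (simp add: k ac_simps)
      then show ?thesis
        using bound[of "N + i" n] N by (simp add: k dist_commute)
    qed
    then show "\<exists>N. \<forall>n\<ge>N. dist (F n) (F N) < e"
      by blast
  qed
qed

text \<open>Fatou's lemma. Completeness of Lebesgue measure makes the almost everywhere limit
  measurable. The bounds \<open>c l\<close> may vary with \<open>l\<close>, so that energies of
  approximants can be inserted.\<close>

lemma nonneg_AE_limit_integrable:
  fixes h :: "nat \<Rightarrow> real \<Rightarrow> real"
  assumes meas: "\<And>l. h l \<in> borel_measurable lebesgue"
    and nonneg: "\<And>l x. 0 \<le> h l x" "\<And>x. 0 \<le> H x"
    and bound: "\<And>l. (\<integral>\<^sup>+x. h l x \<partial>lebesgue) \<le> ennreal (c l)" and c: "c \<longlonglongrightarrow> c0" "0 \<le> c0"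
    and lim: "AE x in lebesgue. (\<lambda>l. h l x) \<longlonglongrightarrow> H x"
  shows "integrable lebesgue H" "(LINT x|lebesgue. H x) \<le> c0"
proof -
  have "(\<lambda>x. lim (\<lambda>l. h l x)) \<in> borel_measurable lebesgue"
    using meas by (rule borel_measurable_lim_metric)
  moreover have "AE x in lebesgue. lim (\<lambda>l. h l x) = H x"
    using lim by eventually_elim (rule limI)
  ultimately have H: "H \<in> borel_measurable lebesgue"
    by (rule borel_measurable_AE)
  have "(\<integral>\<^sup>+x. H x \<partial>lebesgue) = (\<integral>\<^sup>+x. liminf (\<lambda>l. ennreal (h l x)) \<partial>lebesgue)"
    using lim by (intro nn_integral_cong_AE, eventually_elim)
      (intro lim_imp_Liminf[symmetric] tendsto_ennrealI trivial_limit_sequentially)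
  also have "\<dots> \<le> liminf (\<lambda>l. \<integral>\<^sup>+x. h l x \<partial>lebesgue)"
    by (intro nn_integral_liminf) (use meas in measurable)
  also have "\<dots> \<le> liminf (\<lambda>l. ennreal (c l))"
    by (intro Liminf_mono always_eventually allI bound)
  also have "\<dots> = ennreal c0"
    using c by (intro lim_imp_Liminf tendsto_ennrealI) auto
  finally have le: "(\<integral>\<^sup>+x. H x \<partial>lebesgue) \<le> ennreal c0" .
  then show int: "integrable lebesgue H"
    using H nonneg(2) by (intro integrableI_nonneg) (auto simp: le_less_trans[OF le])
  show "(LINT x|lebesgue. H x) \<le> c0"
    using le nn_integral_eq_integral[OF int] nonneg(2) c(2) by simp
qed

text \<open>This moves the energy identity from the gauge integral to the Lebesgue integral;
  nonnegativity of the integrand yields measurability and the decrease of the energy.\<close>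

lemma strong_solution_dissipation:
  fixes B :: "real \<Rightarrow> ('u::{real_inner,complete_space} \<Rightarrow>\<^sub>L ('v::real_inner \<Rightarrow>\<^sub>L real))"
  assumes sol: "strong_solution \<iota> B {a..b} w wt" and "a \<le> b"
  defines "h \<equiv> \<lambda>s. indicator {a..b} s * (norm (dual_adjoint (B s) (wt s)))\<^sup>2"
    and "e \<equiv> E_S w (\<lambda>s. \<iota> (wt s))"
  shows "h \<in> borel_measurable lebesgue" "(\<integral>\<^sup>+s. h s \<partial>lebesgue) = ennreal (e a - e b)" "e b \<le> e a"
proof -
  have h: "h = (\<lambda>s. if s \<in> {a..b} then (norm (dual_adjoint (B s) (wt s)))\<^sup>2 else 0)"
    by (auto simp: h_def indicator_def)
  have "(h has_integral (e a - e b)) UNIV"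
    unfolding h has_integral_restrict_UNIV e_def by (rule strong_solution_energy[OF assms(1,2)])
  moreover have "0 \<le> h s" for s
    by (simp add: h_def)
  ultimately show "h \<in> borel_measurable lebesgue" "(\<integral>\<^sup>+s. h s \<partial>lebesgue) = ennreal (e a - e b)"
    "e b \<le> e a"
    using has_integral_iff_nn_integral_lebesgue[of h] by auto
qed

text \<open>A single diagonal sequence of strong solutions, on intervals exhausting \<open>[a, b)\<close>, gives one
  trace that serves every compact subinterval.\<close>

locale diagonal_approximation =
  fixes \<iota> :: "'v::real_inner \<Rightarrow>\<^sub>L 'h::real_inner"
    and B :: "real \<Rightarrow> ('u::{real_inner,complete_space} \<Rightarrow>\<^sub>L ('v \<Rightarrow>\<^sub>L real))"
    and a b :: real and u :: "real \<Rightarrow> 'v" and ut :: "real \<Rightarrow> 'h"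
    and \<beta> :: "nat \<Rightarrow> real" and W Wt :: "nat \<Rightarrow> real \<Rightarrow> 'v"
  assumes \<beta>: "\<And>j. a < \<beta> j" "\<And>j. \<beta> j < b" "incseq \<beta>" "\<beta> \<longlonglongrightarrow> b"
    and W: "\<And>j. strong_solution \<iota> B {a..\<beta> j} (W j) (Wt j)"
    and close: "\<And>j s. s \<in> {a..\<beta> j} \<Longrightarrow> norm (W j s - u s) \<le> (1/2) ^ j"
      "\<And>j s. s \<in> {a..\<beta> j} \<Longrightarrow> norm (\<iota> (Wt j s) - ut s) \<le> (1/2) ^ j"
    and cont: "continuous_on {a..b} u" "continuous_on {a..b} ut"
begin

lemma a_less_b: "a < b"
  using \<beta>(1,2) less_trans by blast

definition trace_approx :: "nat \<Rightarrow> real \<Rightarrow> 'u" where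
  "trace_approx j s = dual_adjoint (B s) (Wt j s)"

text \<open>Where the sequence diverges the value is arbitrary; convergence holds at almost every
  point of \<open>{a..<b}\<close>.\<close>

definition trace :: "real \<Rightarrow> 'u" where
  "trace s = lim (\<lambda>j. trace_approx j s)"

lemma eventually_below: "s < b \<Longrightarrow> \<exists>i. \<forall>j\<ge>i. s < \<beta> j"
  using order_tendstoD(1)[OF \<beta>(4)] by (simp add: eventually_sequentially)

text \<open>The evaluation point may move with \<open>l\<close>. The choice
  \<open>\<sigma> = \<beta>\<close> reaches the energy at \<open>b\<close>, although each
  approximant is a solution only up to \<open>\<beta> l\<close>.\<close>

lemma energy_tendsto:
  assumes mem: "\<forall>\<^sub>F l in sequentially. \<sigma> l \<in> {a..\<beta> l}" and lim: "\<sigma> \<longlonglongrightarrow> s" and s: "s \<in> {a..b}"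
  shows "(\<lambda>l. E_S (W l) (\<lambda>s. \<iota> (Wt l s)) (\<sigma> l)) \<longlonglongrightarrow> E_S u ut s"
proof -
  have half: "(\<lambda>j. (1/2) ^ j :: real) \<longlonglongrightarrow> 0"
    by (rule LIMSEQ_realpow_zero) auto
  have in_ab: "\<forall>\<^sub>F l in sequentially. \<sigma> l \<in> {a..b}"
    using mem by eventually_elim (use \<beta>(2) less_imp_le order_trans in fastforce)
  have "(\<lambda>l. W l (\<sigma> l) - u (\<sigma> l)) \<longlonglongrightarrow> 0"
    using mem by (intro Lim_null_comparison[OF _ half], eventually_elim) (rule close(1))
  moreover have "(\<lambda>l. u (\<sigma> l)) \<longlonglongrightarrow> u s"
    using cont(1) lim s in_ab by (rule continuous_on_tendsto_compose)
  ultimately have 1: "(\<lambda>l. W l (\<sigma> l)) \<longlonglongrightarrow> u s"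
    using tendsto_add by fastforce
  have "(\<lambda>l. \<iota> (Wt l (\<sigma> l)) - ut (\<sigma> l)) \<longlonglongrightarrow> 0"
    using mem by (intro Lim_null_comparison[OF _ half], eventually_elim) (rule close(2))
  moreover have "(\<lambda>l. ut (\<sigma> l)) \<longlonglongrightarrow> ut s"
    using cont(2) lim s in_ab by (rule continuous_on_tendsto_compose)
  ultimately have 2: "(\<lambda>l. \<iota> (Wt l (\<sigma> l))) \<longlonglongrightarrow> ut s"
    using tendsto_add by fastforce
  show ?thesis
    unfolding E_S_def by (intro tendsto_intros 1 2) simp
qed

text \<open>Each approximant dissipates energy, and the inequality between two fixed times passes to
  the limit.\<close>

lemma energy_le_initial:
  assumes "s \<in> {a..<b}"
  shows "E_S u ut s \<le> E_S u ut a"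
proof (rule LIMSEQ_le)
  obtain i where i: "\<And>j. i \<le> j \<Longrightarrow> s < \<beta> j"
    using eventually_below assms by auto
  have s: "\<forall>\<^sub>F l in sequentially. s \<in> {a..\<beta> l}"
    using i assms by (auto simp: eventually_sequentially intro!: exI[of _ i] less_imp_le)
  show "(\<lambda>l. E_S (W l) (\<lambda>s. \<iota> (Wt l s)) s) \<longlonglongrightarrow> E_S u ut s"
    using s assms by (intro energy_tendsto) auto
  show "(\<lambda>l. E_S (W l) (\<lambda>s. \<iota> (Wt l s)) a) \<longlonglongrightarrow> E_S u ut a"
    using \<beta>(1) a_less_b by (intro energy_tendsto) (auto simp: less_imp_le)
  have "E_S (W j) (\<lambda>s. \<iota> (Wt j s)) s \<le> E_S (W j) (\<lambda>s. \<iota> (Wt j s)) a" if "i \<le> j" for j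
    using assms i[OF that]
    by (intro strong_solution_dissipation(3)[OF strong_solution_subset[OF W[of j]]]) auto
  then show "\<exists>N. \<forall>n\<ge>N. E_S (W n) (\<lambda>s. \<iota> (Wt n s)) s \<le> E_S (W n) (\<lambda>s. \<iota> (Wt n s)) a"
    by blast
qed

text \<open>The difference of two approximants is a strong solution, so what it dissipates is at
  most its energy at \<open>c\<close>. Both lie within \<open>(1/2) ^ i\<close> of the trajectory
  there, so each component of the difference has norm at most \<open>2 * (1/2) ^ i\<close>, and the
  energy is at most the square of this.\<close>

lemma trace_approx_Cauchy_L2:
  assumes sub: "{c..d} \<subseteq> {a..\<beta> i}" and ij: "i \<le> j" "i \<le> k" and "c \<le> d"
  defines "h \<equiv> \<lambda>s. indicator {c..d} s * (norm (trace_approx j s - trace_approx k s))\<^sup>2"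
  shows "h \<in> borel_measurable lebesgue" "(\<integral>\<^sup>+s. h s \<partial>lebesgue) \<le> ennreal (4 * (1/4) ^ i)"
proof -
  have ac: "a \<le> c" "d \<le> \<beta> i"
    using sub \<open>c \<le> d\<close> by auto
  have mono: "{c..d} \<subseteq> {a..\<beta> j}" "{c..d} \<subseteq> {a..\<beta> k}"
    using ac incseqD[OF \<beta>(3) ij(1)] incseqD[OF \<beta>(3) ij(2)] by auto
  define w where "w s = W j s - W k s" for s
  define wt where "wt s = Wt j s - Wt k s" for s
  have sol: "strong_solution \<iota> B {c..d} w wt"
    unfolding w_def wt_def using mono
    by (intro strong_solution_diff strong_solution_subset[OF W])
  have h: "h = (\<lambda>s. indicator {c..d} s * (norm (dual_adjoint (B s) (wt s)))\<^sup>2)"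
    by (simp add: h_def trace_approx_def wt_def dual_adjoint_diff)
  note diss = strong_solution_dissipation[OF sol \<open>c \<le> d\<close>]
  show "h \<in> borel_measurable lebesgue"
    unfolding h by (rule diss)
  have small: "(1/2) ^ j \<le> (1/2 :: real) ^ i" "(1/2) ^ k \<le> (1/2 :: real) ^ i"
    using ij by (auto intro: power_decreasing)
  have c: "c \<in> {a..\<beta> j}" "c \<in> {a..\<beta> k}"
    using mono \<open>c \<le> d\<close> by auto
  have "norm (w c) \<le> 2 * (1/2) ^ i"
    using norm_triangle_ineq4[of "W j c - u c" "W k c - u c"]
      close(1)[OF c(1)] close(1)[OF c(2)] small
    unfolding w_def diff_diff_eq2 diff_add_cancel by linarith
  then have 1: "(norm (w c))\<^sup>2 \<le> (2 * (1/2) ^ i)\<^sup>2"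
    by (rule power_mono) simp
  have "norm (\<iota> (wt c)) \<le> 2 * (1/2) ^ i"
    using norm_triangle_ineq4[of "\<iota> (Wt j c) - ut c" "\<iota> (Wt k c) - ut c"]
      close(2)[OF c(1)] close(2)[OF c(2)] small
    unfolding wt_def blinfun.diff_right diff_diff_eq2 diff_add_cancel by linarith
  then have 2: "(norm (\<iota> (wt c)))\<^sup>2 \<le> (2 * (1/2) ^ i)\<^sup>2"
    by (rule power_mono) simp
  have "(2 * (1/2) ^ i)\<^sup>2 = 4 * (1/4 :: real) ^ i"
    by (simp add: power_mult_distrib power2_eq_square flip: power_mult_distrib)
  then have "E_S w (\<lambda>s. \<iota> (wt s)) c \<le> 4 * (1/4) ^ i"
    unfolding E_S_def using 1 2 by simp
  moreover have "0 \<le> E_S w (\<lambda>s. \<iota> (wt s)) d"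
    by (simp add: E_S_def)
  ultimately show "(\<integral>\<^sup>+s. h s \<partial>lebesgue) \<le> ennreal (4 * (1/4) ^ i)"
    unfolding h diss(2) by (intro ennreal_leI) simp
qed

text \<open>The L2 bounds leave room for a weight: the integrals of \<open>2 ^ j * x j s\<close> are
  still summable, so the weighted series is finite almost everywhere. At such a point the successive
  distances decay geometrically with ratio \<open>sqrt (1/2)\<close>, and completeness gives the
  limit.\<close>

lemma trace_approx_AE_tendsto:
  "AE s in lebesgue. s \<in> {a..<b} \<longrightarrow> (\<lambda>j. trace_approx j s) \<longlonglongrightarrow> trace s"
proof -
  define x where "x j s = indicator {a..\<beta> j} s *
      (norm (trace_approx j s - trace_approx (Suc j) s))\<^sup>2" for j s
  have x: "x j \<in> borel_measurable lebesgue"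
    "(\<integral>\<^sup>+s. x j s \<partial>lebesgue) \<le> ennreal (4 * (1/4) ^ j)" for j
    unfolding x_def using less_imp_le[OF \<beta>(1)[of j]] by (auto intro!: trace_approx_Cauchy_L2)
  have x0: "0 \<le> x j s" for j s
    by (simp add: x_def)
  have [measurable]: "(\<lambda>s. ennreal (2 ^ j * x j s)) \<in> borel_measurable lebesgue" for j
    using x(1)[of j] by measurable
  have "(\<integral>\<^sup>+s. (\<Sum>j. ennreal (2 ^ j * x j s)) \<partial>lebesgue) = (\<Sum>j. \<integral>\<^sup>+s. ennreal (2 ^ j * x j s) \<partial>lebesgue)"
    by (rule nn_integral_suminf) measurable
  also have "\<dots> \<le> (\<Sum>j. ennreal (4 * (1/2) ^ j))"
  proof (rule suminf_le)
    fix j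
    have "(\<integral>\<^sup>+s. ennreal (2 ^ j * x j s) \<partial>lebesgue) = ennreal (2 ^ j) * (\<integral>\<^sup>+s. x j s \<partial>lebesgue)"
      using x(1)[of j] x0 by (subst nn_integral_cmult[symmetric]) (auto simp: ennreal_mult)
    also have "\<dots> \<le> ennreal (2 ^ j) * ennreal (4 * (1/4) ^ j)"
      by (intro mult_left_mono x) simp
    also have "\<dots> = ennreal (2 ^ j * (4 * (1/4) ^ j))"
      by (simp add: ennreal_mult)
    also have "2 ^ j * (4 * (1/4) ^ j) = 4 * (1/2 :: real) ^ j"
      by (simp flip: power_mult_distrib)
    finally show "(\<integral>\<^sup>+s. ennreal (2 ^ j * x j s) \<partial>lebesgue) \<le> ennreal (4 * (1/2) ^ j)" .
  qed auto
  also have "\<dots> = ennreal (\<Sum>j. 4 * (1/2) ^ j)"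
    by (intro suminf_ennreal2 summable_mult summable_geometric) auto
  finally have "(\<integral>\<^sup>+s. (\<Sum>j. ennreal (2 ^ j * x j s)) \<partial>lebesgue) \<noteq> \<infinity>"
    using ennreal_less_top le_less_trans less_irrefl by (metis infinity_ennreal_def)
  then have "AE s in lebesgue. (\<Sum>j. ennreal (2 ^ j * x j s)) \<noteq> \<infinity>"
    by (intro nn_integral_PInf_AE) measurable
  then show ?thesis
  proof eventually_elim
    case (elim s)
    show ?case
    proof
      assume s: "s \<in> {a..<b}"
      obtain S where S: "(\<Sum>j. ennreal (2 ^ j * x j s)) = ennreal S" "0 \<le> S"
        using elim by (cases "\<Sum>j. ennreal (2 ^ j * x j s)") auto
      have le_S: "2 ^ j * x j s \<le> S" for j
      proof -
        have "ennreal (2 ^ j * x j s) \<le> (\<Sum>j. ennreal (2 ^ j * x j s))"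
          using sum_le_suminf[of "\<lambda>j. ennreal (2 ^ j * x j s)" "{j}"] by auto
        then show ?thesis
          unfolding S(1) using S(2) by simp
      qed
      obtain i where i: "\<And>j. i \<le> j \<Longrightarrow> s < \<beta> j"
        using eventually_below s by auto
      have "dist (trace_approx j s) (trace_approx (Suc j) s) \<le> sqrt S * (sqrt (1/2)) ^ j"
        if "i \<le> j" for j
      proof -
        have "2 ^ j * (dist (trace_approx j s) (trace_approx (Suc j) s))\<^sup>2 \<le> S"
          using le_S[of j] i[OF that] s by (simp add: x_def dist_norm)
        then have "(dist (trace_approx j s) (trace_approx (Suc j) s))\<^sup>2 \<le> S * (1/2) ^ j"
          by (simp add: field_simps)
        then have "dist (trace_approx j s) (trace_approx (Suc j) s) \<le> sqrt (S * (1/2) ^ j)"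
          by (rule real_le_rsqrt)
        then show ?thesis
          by (simp add: real_sqrt_mult real_sqrt_power del: power_one_over)
      qed
      then have "Cauchy (\<lambda>j. trace_approx j s)"
        by (rule Cauchy_geometric_steps) auto
      then show "(\<lambda>j. trace_approx j s) \<longlonglongrightarrow> trace s"
        unfolding trace_def by (simp add: Cauchy_convergent_iff convergent_LIMSEQ_iff)
    qed
  qed
qed

text \<open>On a compact subinterval ending at \<open>d\<close> the diagonal sequence is shifted by
  an \<open>i\<close> with \<open>d < \<beta> i\<close>, so that all its members live there. Uniform
  convergence is built into the locale; L2 convergence comes from the Cauchy bound.\<close>

lemma trace_is_damping_trace: "damping_trace \<iota> B {a..<b} u ut trace"
  unfolding damping_trace_def
proof (intro allI impI)
  fix c d assume "c < d \<and> {c..d} \<subseteq> {a..<b}"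
  moreover from this have "c \<in> {a..<b}" "d \<in> {a..<b}"
    using subsetD[of "{c..d}" "{a..<b}" c] subsetD[of "{c..d}" "{a..<b}" d] by simp_all
  ultimately have cd: "a \<le> c" "c < d" "d < b"
    by auto
  obtain i where i: "d < \<beta> i"
    using eventually_below[OF \<open>d < b\<close>] by blast
  have sub: "{c..d} \<subseteq> {a..\<beta> (k + i)}" for k
    using cd i incseqD[OF \<beta>(3), of i "k + i"] by auto
  have half: "(\<lambda>k. (1/2) ^ (k + i) :: real) \<longlonglongrightarrow> 0"
    by (intro LIMSEQ_ignore_initial_segment LIMSEQ_realpow_zero) auto
  have app: "strong_approximation \<iota> B {c..d} (\<lambda>k. W (k + i)) (\<lambda>k. Wt (k + i)) u ut"
    unfolding strong_approximation_def
  proof (intro conjI allI)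
    show "strong_solution \<iota> B {c..d} (W (k + i)) (Wt (k + i))" for k
      using W sub by (rule strong_solution_subset)
    have small: "\<forall>\<^sub>F k in sequentially. (1/2) ^ (k + i) < e" if "e > 0" for e :: real
      using half that by (simp add: order_tendstoD)
    show "uniform_limit {c..d} (\<lambda>k. W (k + i)) u sequentially"
    proof (rule uniform_limitI)
      fix e :: real assume "e > 0"
      from small[OF this] show "\<forall>\<^sub>F k in sequentially. \<forall>s\<in>{c..d}. dist (W (k + i) s) (u s) < e"
        by eventually_elim
          (auto simp: dist_norm intro: le_less_trans[OF close(1)[OF subsetD[OF sub]]])
    qed
    show "uniform_limit {c..d} (\<lambda>k s. \<iota> (Wt (k + i) s)) ut sequentially"
    proof (rule uniform_limitI)
      fix e :: real assume "e > 0"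
      from small[OF this]
      show "\<forall>\<^sub>F k in sequentially. \<forall>s\<in>{c..d}. dist (\<iota> (Wt (k + i) s)) (ut s) < e"
        by eventually_elim
          (auto simp: dist_norm intro: le_less_trans[OF close(2)[OF subsetD[OF sub]]])
    qed
  qed
  define H where "H k s = indicator {c..d} s * (norm (trace_approx (k + i) s - trace s))\<^sup>2" for k s
  have H: "integrable lebesgue (H k)" "(LINT s|lebesgue. H k s) \<le> 4 * (1/4) ^ (k + i)" for k
  proof -
    \<comment> \<open>With \<open>k\<close> fixed, \<open>l\<close> sends the second index of the
      Cauchy bound to infinity, and Fatou's lemma replaces it by \<open>trace\<close>.\<close>
    define h where
      "h l s = indicator {c..d} s * (norm (trace_approx (k + i) s - trace_approx (l + (k + i)) s))\<^sup>2"
      for l s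
    have h: "h l \<in> borel_measurable lebesgue"
      "(\<integral>\<^sup>+s. h l s \<partial>lebesgue) \<le> ennreal (4 * (1/4) ^ (k + i))" for l
      unfolding h_def using cd by (auto intro!: trace_approx_Cauchy_L2[OF sub[of k]])
    have "AE s in lebesgue. (\<lambda>l. h l s) \<longlonglongrightarrow> H k s"
      using trace_approx_AE_tendsto
    proof eventually_elim
      case (elim s)
      show ?case
      proof (cases "s \<in> {c..d}")
        case True
        then have "(\<lambda>l. trace_approx (l + (k + i)) s) \<longlonglongrightarrow> trace s"
          using elim cd by (intro LIMSEQ_ignore_initial_segment) auto
        then show ?thesis
          unfolding h_def H_def by (intro tendsto_intros)
      qed (simp add: h_def H_def)
    qed
    then show "integrable lebesgue (H k)" "(LINT s|lebesgue. H k s) \<le> 4 * (1/4) ^ (k + i)"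
      using nonneg_AE_limit_integrable[of h "H k" "\<lambda>_. 4 * (1/4) ^ (k + i)" "4 * (1/4) ^ (k + i)"] h
      by (auto simp: h_def H_def)
  qed
  have "(\<lambda>k. LINT s|lebesgue. H k s) \<longlonglongrightarrow> 0"
  proof (rule tendsto_sandwich[of "\<lambda>_. 0" _ _ "\<lambda>k. 4 * (1/4) ^ (k + i)"])
    have "(\<lambda>k. 4 * (1/4) ^ (k + i) :: real) \<longlonglongrightarrow> 4 * 0"
      by (intro tendsto_intros LIMSEQ_ignore_initial_segment LIMSEQ_realpow_zero) auto
    then show "(\<lambda>k. 4 * (1/4) ^ (k + i) :: real) \<longlonglongrightarrow> 0"
      by simp
  qed (use H(2) in \<open>auto simp: H_def intro!: always_eventually\<close>)
  then show "\<exists>wk wtk. strong_approximation \<iota> B {c..d} wk wtk u ut \<and>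
      (\<forall>k. set_integrable lebesgue {c..d} (\<lambda>s. (norm (dual_adjoint (B s) (wtk k s) - trace s))\<^sup>2)) \<and>
      (\<lambda>k. LINT s:{c..d}|lebesgue. (norm (dual_adjoint (B s) (wtk k s) - trace s))\<^sup>2) \<longlonglongrightarrow> 0"
    using app H(1) unfolding H_def trace_approx_def set_integrable_def set_lebesgue_integral_def
    by (intro exI[of _ "\<lambda>k. W (k + i)"] exI[of _ "\<lambda>k. Wt (k + i)"]) simp
qed

text \<open>Fatou's lemma is applied to the energy identities on \<open>{a..\<beta> l}\<close>,
  whose right-hand sides converge. It yields an inequality, in the direction that observability
  calls for.\<close>

lemma trace_dissipation:
  "(LINT s:{a..b}|lebesgue. (norm (trace s))\<^sup>2) \<le> E_S u ut a - E_S u ut b"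
proof -
  define h where "h l s = indicator {a..\<beta> l} s * (norm (trace_approx l s))\<^sup>2" for l s
  define H where "H s = indicator {a..b} s * (norm (trace s))\<^sup>2" for s
  define c where "c l = E_S (W l) (\<lambda>s. \<iota> (Wt l s)) a - E_S (W l) (\<lambda>s. \<iota> (Wt l s)) (\<beta> l)" for l
  have h: "h l \<in> borel_measurable lebesgue" "(\<integral>\<^sup>+s. h l s \<partial>lebesgue) \<le> ennreal (c l)" "0 \<le> c l" for l
    unfolding h_def trace_approx_def c_def
    using strong_solution_dissipation[OF W less_imp_le[OF \<beta>(1)], of l] by auto
  have c: "c \<longlonglongrightarrow> E_S u ut a - E_S u ut b"
    unfolding c_def using \<beta>(1,4) a_less_b
    by (intro tendsto_diff energy_tendsto) (auto simp: less_imp_le)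
  have c0: "0 \<le> E_S u ut a - E_S u ut b"
    using c by (rule LIMSEQ_le_const) (use h(3) in blast)
  \<comment> \<open>The endpoint \<open>b\<close> lies in no \<open>{a..\<beta> l}\<close>, so
    \<open>h l b\<close> is 0 while \<open>H b\<close> is uncontrolled; it is discarded as a null
    set.\<close>
  have "AE s in lebesgue. s \<noteq> b"
    by (intro AE_completion AE_lborel_singleton)
  then have "AE s in lebesgue. (\<lambda>l. h l s) \<longlonglongrightarrow> H s"
    using trace_approx_AE_tendsto
  proof eventually_elim
    case (elim s)
    show ?case
    proof (cases "s \<in> {a..<b}")
      case True
      then obtain i where i: "\<And>j. i \<le> j \<Longrightarrow> s < \<beta> j"
        using eventually_below by auto
      have "(\<lambda>l. (norm (trace_approx l s))\<^sup>2) \<longlonglongrightarrow> (norm (trace s))\<^sup>2"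
        using elim True by (intro tendsto_intros) auto
      moreover have "\<forall>\<^sub>F l in sequentially. (norm (trace_approx l s))\<^sup>2 = h l s"
        unfolding eventually_sequentially h_def using i True
        by (intro exI[of _ i]) (simp add: less_imp_le)
      ultimately have "(\<lambda>l. h l s) \<longlonglongrightarrow> (norm (trace s))\<^sup>2"
        by (rule Lim_transform_eventually)
      then show ?thesis
        using True by (simp add: H_def)
    next
      case False
      then have "s \<notin> {a..b}" "s \<notin> {a..\<beta> l}" for l
        using elim \<beta>(2)[of l] by auto
      then show ?thesis
        by (simp add: h_def H_def)
    qed
  qed
  then have "(LINT s|lebesgue. H s) \<le> E_S u ut a - E_S u ut b"
    using h c c0 by (intro nonneg_AE_limit_integrable(2)[of h H c]) (auto simp: h_def H_def)
  then show ?thesis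
    by (simp add: H_def set_lebesgue_integral_def)
qed

end

lemma diagonal_approximation_exists:
  fixes B :: "real \<Rightarrow> ('u::{real_inner,complete_space} \<Rightarrow>\<^sub>L ('v::real_inner \<Rightarrow>\<^sub>L real))"
  assumes "a < b" and lim: "limit_of_strong \<iota> B {a..<b} u ut"
    and cont: "continuous_on {a..b} u" "continuous_on {a..b} ut"
  obtains \<beta> W Wt where "diagonal_approximation \<iota> B a b u ut \<beta> W Wt"
proof -
  \<comment> \<open>The denominator starts at 2, which keeps \<open>\<beta> 0\<close> strictly above
    \<open>a\<close>.\<close>
  define \<beta> where "\<beta> j = b - (b - a) * (1 / real (Suc (Suc j)))" for j
  have frac: "(b - a) * (1 / real (Suc (Suc j))) < b - a" for j
    using \<open>a < b\<close> by (simp add: divide_less_eq)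
  have \<beta>: "a < \<beta> j" "\<beta> j < b" for j
    using \<open>a < b\<close> frac[of j] by (auto simp: \<beta>_def)
  have "incseq \<beta>"
    unfolding incseq_def \<beta>_def using \<open>a < b\<close>
    by (intro allI impI diff_left_mono mult_left_mono divide_left_mono) auto
  moreover have "\<beta> \<longlonglongrightarrow> b - (b - a) * 0"
    unfolding \<beta>_def
    using LIMSEQ_ignore_initial_segment[OF LIMSEQ_inverse_real_of_nat, of 1]
    by (intro tendsto_intros) (simp add: inverse_eq_divide)
  moreover have "\<exists>w wt. strong_solution \<iota> B {a..\<beta> j} w wt \<and>
      (\<forall>s\<in>{a..\<beta> j}. norm (w s - u s) \<le> (1/2) ^ j \<and> norm (\<iota> (wt s) - ut s) \<le> (1/2) ^ j)" for j
  proof -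
    have "{a..\<beta> j} \<subseteq> {a..<b}"
      using \<beta>[of j] by auto
    then obtain wk wtk where *: "strong_approximation \<iota> B {a..\<beta> j} wk wtk u ut"
      using lim \<beta>(1)[of j] unfolding limit_of_strong_def by blast
    then have "\<forall>\<^sub>F k in sequentially. \<forall>s\<in>{a..\<beta> j}. dist (wk k s) (u s) < (1/2) ^ j"
      "\<forall>\<^sub>F k in sequentially. \<forall>s\<in>{a..\<beta> j}. dist (\<iota> (wtk k s)) (ut s) < (1/2) ^ j"
      unfolding strong_approximation_def by (auto dest!: uniform_limitD[where e = "(1/2) ^ j"])
    then have "\<forall>\<^sub>F k in sequentially. \<forall>s\<in>{a..\<beta> j}.
        norm (wk k s - u s) \<le> (1/2) ^ j \<and> norm (\<iota> (wtk k s) - ut s) \<le> (1/2) ^ j"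
      by eventually_elim (simp add: dist_norm less_imp_le)
    then obtain k where "\<forall>s\<in>{a..\<beta> j}.
        norm (wk k s - u s) \<le> (1/2) ^ j \<and> norm (\<iota> (wtk k s) - ut s) \<le> (1/2) ^ j"
      by (auto simp: eventually_sequentially)
    then show ?thesis
      using * unfolding strong_approximation_def by blast
  qed
  then obtain W Wt where "\<And>j. strong_solution \<iota> B {a..\<beta> j} (W j) (Wt j) \<and>
      (\<forall>s\<in>{a..\<beta> j}. norm (W j s - u s) \<le> (1/2) ^ j \<and> norm (\<iota> (Wt j s) - ut s) \<le> (1/2) ^ j)"
    by metis
  ultimately have "diagonal_approximation \<iota> B a b u ut \<beta> W Wt"
    using \<beta> cont by unfold_locales auto
  then show ?thesis
    by (rule that)
qed

section \<open>Contraction of the energy on the damped intervals\<close>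

text \<open>With \<open>trace\<close> in the role of \<open>g\<close>, observability and dissipation
  combine to E(b) \<le> \<delta> (E(a) - E(b)), which is solved for E(b).\<close>

lemma observability_contraction:
  fixes B :: "real \<Rightarrow> ('u::{real_inner,complete_space} \<Rightarrow>\<^sub>L ('v::real_inner \<Rightarrow>\<^sub>L real))"
  assumes "a < b" "0 < \<delta>" and u: "energy_class \<iota> {a..b} u ut" "limit_of_strong \<iota> B {a..<b} u ut"
    and obs: "\<And>g. weak_solution \<iota> B a b (u a) (ut a) u ut \<Longrightarrow> damping_trace \<iota> B {a..<b} u ut g \<Longrightarrow>
      E_S u ut b \<le> \<delta> * (LINT s:{a..b}|lebesgue. (norm (g s))\<^sup>2)"
  shows "E_S u ut b \<le> \<delta> / (\<delta> + 1) * E_S u ut a" "\<And>s. s \<in> {a..b} \<Longrightarrow> E_S u ut s \<le> E_S u ut a"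
proof -
  obtain \<beta> W Wt where "diagonal_approximation \<iota> B a b u ut \<beta> W Wt"
    using diagonal_approximation_exists[OF \<open>a < b\<close> u(2)] u(1) by (auto simp: energy_class_def)
  then interpret diagonal_approximation \<iota> B a b u ut \<beta> W Wt .
  have "weak_solution \<iota> B a b (u a) (ut a) u ut"
    using u by (simp add: weak_solution_def)
  from obs[OF this trace_is_damping_trace]
  have "E_S u ut b \<le> \<delta> * (E_S u ut a - E_S u ut b)"
    using mult_left_mono[OF trace_dissipation less_imp_le[OF \<open>0 < \<delta>\<close>]] by (rule order_trans)
  then show le: "E_S u ut b \<le> \<delta> / (\<delta> + 1) * E_S u ut a"
    using \<open>0 < \<delta>\<close> by (simp add: field_simps)
  \<comment> \<open>\<open>energy_le_initial\<close> stops short of \<open>b\<close>; there the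
    contraction itself gives the bound, its factor being at most 1.\<close>
  have "\<delta> / (\<delta> + 1) * E_S u ut a \<le> E_S u ut a"
    using \<open>0 < \<delta>\<close> by (simp add: field_simps E_S_def)
  then show "E_S u ut s \<le> E_S u ut a" if "s \<in> {a..b}" for s
    using energy_le_initial[of s] le that by (cases "s = b") auto
qed

section \<open>Growth of the energy on the delay intervals\<close>

text \<open>Small forward shifts stay inside the interval even from the left endpoint, so the
  derivative within \<open>{a..b}\<close> suffices there and the energy at \<open>a\<close> is
  recovered from averages.\<close>

lemma forward_difference_quotient_tendsto:
  fixes F :: "real \<Rightarrow> 'a::real_normed_vector"
  assumes der: "(F has_vector_derivative F') (at r within {a..b})" and r: "a \<le> r" "r < b"
  shows "((\<lambda>h. (1 / h) *\<^sub>R (F (r + h) - F r)) \<longlongrightarrow> F') (at_right 0)"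
proof -
  have "((\<lambda>y. (1 / norm (y - r)) *\<^sub>R (F y - (F r + (y - r) *\<^sub>R F'))) \<longlongrightarrow> 0) (at r within {a..b})"
    using der unfolding has_vector_derivative_def has_derivative_within by blast
  moreover have "filterlim (\<lambda>h. r + h) (at r within {a..b}) (at_right 0)"
    unfolding filterlim_at
  proof
    have "((\<lambda>h. r + h) \<longlongrightarrow> r + 0) (at_right 0)"
      by (intro tendsto_intros)
    then show "((\<lambda>h. r + h) \<longlongrightarrow> r) (at_right 0)"
      by simp
    show "\<forall>\<^sub>F h in at_right 0. r + h \<in> {a..b} \<and> r + h \<noteq> r"
      unfolding eventually_at_right_field using r by (intro exI[of _ "b - r"]) auto
  qed
  ultimately have "((\<lambda>h. (1 / norm (r + h - r)) *\<^sub>R (F (r + h) - (F r + (r + h - r) *\<^sub>R F'))) \<longlongrightarrow> 0)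
      (at_right 0)"
    by (rule filterlim_compose)
  moreover have "\<forall>\<^sub>F h in at_right 0. (1 / norm (r + h - r)) *\<^sub>R (F (r + h) - (F r + (r + h - r) *\<^sub>R F')) =
      (1 / h) *\<^sub>R (F (r + h) - F r) - F'"
    unfolding eventually_at_right_field
    by (intro exI[of _ 1]) (simp add: scaleR_diff_right scaleR_add_right)
  ultimately have "((\<lambda>h. (1 / h) *\<^sub>R (F (r + h) - F r) - F') \<longlongrightarrow> 0) (at_right 0)"
    by (rule Lim_transform_eventually)
  then show ?thesis
    by (simp add: LIM_zero_iff)
qed

text \<open>Since \<open>u\<^sub>t\<close> is only \<open>H\<close>-valued, the energy balance cannot be differentiated directly. It is
  applied to the forward averages \<open>u\<^sub>h(r) = (U (r + h) - U r) / h\<close> with \<open>U' = u\<close>, whose time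
  derivative lies in \<open>V\<close>, and \<open>h\<close> tends to \<open>0\<close> in the resulting Gronwall inequality.\<close>

lemma forced_energy_growth:
  fixes \<iota> :: "'v::{real_inner,complete_space} \<Rightarrow>\<^sub>L 'h::real_inner"
    and u :: "real \<Rightarrow> 'v" and ut f :: "real \<Rightarrow> 'h"
  assumes "a < b" and u: "energy_class \<iota> {a..b} u ut"
    and eqn: "\<And>s. s \<in> {a..<b} \<Longrightarrow> ((\<lambda>r. pivot \<iota> (ut r)) has_vector_derivative
        - (A_ext (u s) + pivot \<iota> (f s))) (at s within {a..<b})"
    and f: "\<And>s. s \<in> {a..<b} \<Longrightarrow> norm (f s) \<le> \<kappa> * sqrt (2 * e)"
    and nonneg: "0 \<le> \<kappa>" "0 \<le> e"
    and s: "s \<in> {a..b}"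
  shows "E_S u ut s + e \<le> exp (\<kappa> * (s - a)) * (E_S u ut a + e)"
proof -
  have cont: "continuous_on {a..b} u" "continuous_on {a..b} ut"
    and ut: "\<And>s. s \<in> {a..b} \<Longrightarrow> ((\<lambda>r. \<iota> (u r)) has_vector_derivative ut s) (at s within {a..b})"
    using u by (auto simp: energy_class_def)
  obtain U where U: "\<And>s. s \<in> {a..b} \<Longrightarrow> (U has_vector_derivative u s) (at s within {a..b})"
    using continuous_antiderivative[OF cont(1)] by blast
  have contU: "continuous_on {a..b} U"
    by (rule continuous_on_vector_derivative) (rule U)
  \<comment> \<open>The term \<open>A_ext (u r)\<close> cancels between the two derivatives, so
    \<open>Q\<close> varies only through the forcing \<open>f\<close>.\<close>
  define Q where "Q r = pivot \<iota> (ut r) + A_ext (U r)" for r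
  have Q: "(Q has_vector_derivative - pivot \<iota> (f r)) (at r within {a..<b})" if "r \<in> {a..<b}" for r
  proof -
    have "((\<lambda>r. A_ext (U r)) has_vector_derivative A_ext (u r)) (at r within {a..<b})"
      unfolding A_ext_def
    proof (rule bounded_linear.has_vector_derivative[OF bounded_linear_blinfun_inner_right])
      show "(U has_vector_derivative u r) (at r within {a..<b})"
        using U[of r] that by (auto elim: has_vector_derivative_within_subset)
    qed
    from has_vector_derivative_add[OF eqn[OF that] this] show ?thesis
      unfolding Q_def by simp
  qed
  \<comment> \<open>\<open>s < b\<close> leaves room for the forward shift \<open>h\<close>; both
    endpoints are added by continuity at the end.\<close>
  have inside: "E_S u ut s + e \<le> exp (\<kappa> * (s - a)) * (E_S u ut a + e)" if s: "a < s" "s < b" for s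
  proof -
    define uh where "uh h r = (1 / h) *\<^sub>R (U (r + h) - U r)" for h r
    define z where "z h r = (1 / h) *\<^sub>R (u (r + h) - u r)" for h r
    define yh where "yh h r = (1 / h) *\<^sub>R (\<iota> (u (r + h)) - \<iota> (u r))" for h r
    \<comment> \<open>The exponential is the integrating factor: Gronwall's estimate for the
      averages says that \<open>\<phi> h\<close> is nonincreasing.\<close>
    define \<phi> where "\<phi> h r = exp (- \<kappa> * r) * (E_S (uh h) (yh h) r + e)" for h r
    have "\<phi> h s \<le> \<phi> h a" if h: "0 < h" "h < b - s" for h
    proof (rule DERIV_nonpos_imp_decreasing_open[where f = "\<phi> h" and a = a and b = s])
      show "a \<le> s"
        using s by simp
      have "continuous_on {a..s} (\<lambda>r. F (r + h))" if "continuous_on {a..b} F"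
        for F :: "real \<Rightarrow> 'c::topological_space"
        by (rule continuous_on_compose2[OF that]) (use h s in \<open>auto intro!: continuous_intros\<close>)
      moreover have "continuous_on {a..s} F" if "continuous_on {a..b} F"
        for F :: "real \<Rightarrow> 'c::topological_space"
        using that by (rule continuous_on_subset) (use s in auto)
      ultimately show "continuous_on {a..s} (\<phi> h)"
        unfolding \<phi>_def E_S_def uh_def yh_def using h(1) contU cont
        by (intro continuous_intros bounded_linear.continuous_on[OF blinfun.bounded_linear_right]) auto
    next
      fix r assume r: "a < r" "r < s"
      have at: "(F has_vector_derivative F') (at x)"
        if "(F has_vector_derivative F') (at x within {a..b})" "a < x" "x < b"
        for F F' and x :: real
      proof -
        have "at x within {a..b} = at x"
          using that by (intro at_within_interior) simp
        then show ?thesis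
          using that(1) by simp
      qed
      have shift: "((\<lambda>r. (1 / h) *\<^sub>R (F (r + h) - F r)) has_vector_derivative
          (1 / h) *\<^sub>R (F' (r + h) - F' r)) (at r)"
        if "\<And>x. x \<in> {a..b} \<Longrightarrow> (F has_vector_derivative F' x) (at x within {a..b})"
        for F F' :: "real \<Rightarrow> 'c::real_normed_vector"
      proof -
        have 1: "(F has_vector_derivative F' r) (at r)"
          "(F has_vector_derivative F' (r + h)) (at (r + h))"
          using r h s by (auto intro!: at that)
        have "((\<lambda>r. F (r + h)) has_vector_derivative F' (r + h)) (at r)"
          using vector_diff_chain_at[of "\<lambda>r. r + h" 1 r F "F' (r + h)"] 1(2)
          by (simp add: o_def has_vector_derivative_add_const)
        then show ?thesis
          by (intro bounded_linear.has_vector_derivative[OF bounded_linear_scaleR_right]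
              has_vector_derivative_diff 1(1))
      qed
      define D where "D = uh h r \<bullet> z h r + yh h r \<bullet> ((1 / h) *\<^sub>R (ut (r + h) - ut r))"
      have "(uh h has_vector_derivative z h r) (at r)"
        unfolding uh_def z_def by (rule shift[OF U])
      moreover have "(yh h has_vector_derivative (1 / h) *\<^sub>R (ut (r + h) - ut r)) (at r)"
        unfolding yh_def by (rule shift[OF ut])
      ultimately have "(E_S (uh h) (yh h) has_vector_derivative D) (at r)"
        unfolding D_def by (rule E_S_has_vector_derivative)
      then have dE: "(E_S (uh h) (yh h) has_real_derivative D) (at r)"
        by (simp add: has_real_derivative_iff_has_vector_derivative)
      have yz: "yh h r = \<iota> (z h r)"
        by (simp add: yh_def z_def blinfun.scaleR_right blinfun.diff_right)
      \<comment> \<open>Up to the factor \<open>h\<close>, the derivative of the averaged energy is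
        an increment of \<open>Q\<close> tested with the element \<open>z h r\<close> of V, whose
        image in H is \<open>yh h r\<close>.\<close>
      have DQ: "h * D = Q (r + h) (z h r) - Q r (z h r)"
        unfolding D_def Q_def yz uh_def using h(1)
        by (simp add: pivot_def A_ext_def blinfun.add_left inner_diff_left inner_diff_right
            inner_commute field_simps)
      have "((\<lambda>x. Q x (z h r)) has_vector_derivative - (f x \<bullet> yh h r)) (at x within {r..r + h})"
        if "r \<le> x" "x \<le> r + h" for x
      proof -
        have "(Q has_vector_derivative - pivot \<iota> (f x)) (at x within {r..r + h})"
          by (rule has_vector_derivative_within_subset[OF Q]) (use that r s h in auto)
        from bounded_linear.has_vector_derivative[OF blinfun.bounded_linear_left this, of "z h r"]
        show ?thesis
          by (simp add: yz pivot_def blinfun.minus_left)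
      qed
      \<comment> \<open>With \<open>z h r\<close> frozen this is a real function of
        \<open>x\<close>, to which the mean value theorem applies.\<close>
      then have "\<exists>x\<in>{r<..<r + h}. Q (r + h) (z h r) - Q r (z h r) = (r + h - r) *\<^sub>R (- (f x \<bullet> yh h r))"
        using h(1) unfolding has_vector_derivative_def by (intro mvt_simple) auto
      then obtain x where x: "r < x" "x < r + h" "h * D = h * (- (f x \<bullet> yh h r))"
        unfolding DQ by auto
      have "D = - (f x \<bullet> yh h r)"
        using mult_left_cancel[THEN iffD1, OF _ x(3)] h(1) by simp
      also have "\<dots> \<le> norm (f x) * norm (yh h r)"
        using Cauchy_Schwarz_ineq2[of "f x" "yh h r"] by linarith
      also have "\<dots> \<le> \<kappa> * sqrt (2 * e) * norm (yh h r)"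
        using x r s h by (intro mult_right_mono f) auto
      \<comment> \<open>Young's inequality; the factor 2 under the root makes \<open>e\<close>
        appear with coefficient 1.\<close>
      also have "\<dots> \<le> \<kappa> * (e + (norm (yh h r))\<^sup>2 / 2)"
      proof -
        have "0 \<le> (sqrt (2 * e) - norm (yh h r))\<^sup>2"
          by simp
        then have "sqrt (2 * e) * norm (yh h r) \<le> e + (norm (yh h r))\<^sup>2 / 2"
          using nonneg(2) by (simp add: power2_diff)
        then show ?thesis
          using nonneg(1) by (simp add: mult.assoc mult_left_mono)
      qed
      also have "\<dots> \<le> \<kappa> * (E_S (uh h) (yh h) r + e)"
        using nonneg(1) by (intro mult_left_mono) (auto simp: E_S_def)
      finally have D: "D \<le> \<kappa> * (E_S (uh h) (yh h) r + e)" .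
      have "(\<phi> h has_real_derivative exp (- \<kappa> * r) * (D - \<kappa> * (E_S (uh h) (yh h) r + e))) (at r)"
        unfolding \<phi>_def by (rule derivative_eq_intros dE refl | simp)+ (simp add: algebra_simps)
      moreover have "exp (- \<kappa> * r) * (D - \<kappa> * (E_S (uh h) (yh h) r + e)) \<le> 0"
        using D by (simp add: mult_le_0_iff)
      ultimately show "\<exists>y. (\<phi> h has_real_derivative y) (at r) \<and> y \<le> 0"
        by blast
    qed
    then have ev: "\<forall>\<^sub>F h in at_right 0. \<phi> h s \<le> \<phi> h a"
      unfolding eventually_at_right_field using s by (intro exI[of _ "b - s"]) auto
    have lim: "((\<lambda>h. \<phi> h r) \<longlongrightarrow> exp (- \<kappa> * r) * (E_S u ut r + e)) (at_right 0)"
      if "r \<in> {a..<b}" for r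
      unfolding \<phi>_def E_S_def uh_def yh_def
      by (intro tendsto_intros forward_difference_quotient_tendsto[OF U]
          forward_difference_quotient_tendsto[OF ut]) (use that in auto)
    have "exp (- \<kappa> * s) * (E_S u ut s + e) \<le> exp (- \<kappa> * a) * (E_S u ut a + e)"
      by (rule tendsto_le[OF _ lim lim ev]) (use s in auto)
    then have "exp (\<kappa> * s) * (exp (- \<kappa> * s) * (E_S u ut s + e)) \<le>
        exp (\<kappa> * s) * (exp (- \<kappa> * a) * (E_S u ut a + e))"
      by (rule mult_left_mono) simp
    then show ?thesis
      by (simp add: mult.assoc[symmetric] right_diff_distrib flip: exp_add)
  qed
  define \<psi> where "\<psi> s = E_S u ut s + e - exp (\<kappa> * (s - a)) * (E_S u ut a + e)" for s
  have "\<psi> s \<le> 0"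
  proof (rule continuous_le_on_closure[where S = "{a<..<b}" and f = \<psi> and x = s and a = 0])
    show "continuous_on (closure {a<..<b}) \<psi>"
      unfolding \<psi>_def E_S_def using \<open>a < b\<close> cont by (auto intro!: continuous_intros)
    show "\<psi> s \<le> 0" if "s \<in> {a<..<b}" for s
      using inside[of s] that by (simp add: \<psi>_def)
  qed (use s \<open>a < b\<close> in auto)
  then show ?thesis
    by (simp add: \<psi>_def)
qed

text \<open>The bound on the adjoint is used at \<open>v\<close> and at \<open>B z\<close>, where
  \<open>z\<close> is the adjoint image of \<open>v\<close>, after writing the squared norm of
  \<open>B z\<close> as the inner product of \<open>z\<close> with the adjoint image of
  \<open>B z\<close>. A common factor then cancels unless \<open>B z\<close> is 0.\<close>

lemma norm_feedback_le:
  fixes B :: "'u::{real_inner,complete_space} \<Rightarrow>\<^sub>L 'h::real_inner"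
  assumes B: "\<And>v. (norm (adjoint (blinfun_apply B) v))\<^sup>2 \<le> K * (norm v)\<^sup>2" and "0 \<le> K"
  shows "norm (B (adjoint (blinfun_apply B) v)) \<le> K * norm v"
proof -
  define z where "z = adjoint (blinfun_apply B) v"
  have "(norm (B z))\<^sup>2 = z \<bullet> adjoint (blinfun_apply B) (B z)"
    by (simp add: inner_adjoint_blinfun power2_norm_eq_inner)
  also have "\<dots> \<le> norm z * norm (adjoint (blinfun_apply B) (B z))"
    by (rule norm_cauchy_schwarz)
  finally have "((norm (B z))\<^sup>2)\<^sup>2 \<le> (norm z * norm (adjoint (blinfun_apply B) (B z)))\<^sup>2"
    by (rule power_mono) simp
  also have "\<dots> \<le> (K * (norm v)\<^sup>2) * (K * (norm (B z))\<^sup>2)"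
    unfolding power_mult_distrib using \<open>0 \<le> K\<close> B by (intro mult_mono) (auto simp: z_def)
  finally have "(norm (B z))\<^sup>2 * (norm (B z))\<^sup>2 \<le> (K * norm v)\<^sup>2 * (norm (B z))\<^sup>2"
    by (simp add: power2_eq_square ac_simps)
  then have "(norm (B z))\<^sup>2 \<le> (K * norm v)\<^sup>2"
    using mult_right_le_imp_le[of "(norm (B z))\<^sup>2" "(norm (B z))\<^sup>2" "(K * norm v)\<^sup>2"]
    by (cases "B z = 0") simp_all
  then have "norm (B z) \<le> K * norm v"
    by (rule power2_le_imp_le) (use \<open>0 \<le> K\<close> in simp)
  then show ?thesis
    by (simp add: z_def)
qed

section \<open>A contraction recursion with summable perturbation\<close>

text \<open>Divergence of \<open>\<Sum> ln (\<delta> / (\<delta> + 1))\<close> forces that of \<open>\<Sum> 1 / (\<delta> + 1)\<close>, and unlike the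
  logarithm the latter is insensitive to adding \<open>x n\<close> when \<open>\<delta> n\<close> is close to \<open>0\<close>.\<close>

lemma perturbed_contraction_tendsto_0:
  fixes a x \<delta> :: "nat \<Rightarrow> real"
  assumes nonneg: "\<And>n. 0 \<le> a n" "\<And>n. 0 \<le> x n" "\<And>n. 0 < \<delta> n"
    and step: "\<And>n. a (Suc n) + a n \<le> exp (x n) * (\<delta> n / (\<delta> n + 1) * a n + a n)"
    and x: "summable x"
    and ln: "filterlim (\<lambda>N. \<Sum>n<N. ln (\<delta> n / (\<delta> n + 1))) at_bot sequentially"
  shows "a \<longlonglongrightarrow> 0"
proof -
  define c where "c n = 1 / (\<delta> n + 1)" for n
  have c: "0 < c n" "\<delta> n / (\<delta> n + 1) = 1 - c n" for n
    using nonneg(3)[of n] by (auto simp: c_def field_simps)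
  have "\<not> summable c"
  proof
    assume sum_c: "summable c"
    then have "\<forall>\<^sub>F n in sequentially. c n < 1/2"
      by (intro order_tendstoD(2)[OF summable_LIMSEQ_zero]) simp_all
    \<comment> \<open>If \<open>c\<close> were summable, its terms would eventually lie below 1/2,
      where the logarithm is bounded by a multiple of \<open>c\<close>; the sum of logarithms would
      converge, against \<open>ln\<close>.\<close>
    then have "\<forall>\<^sub>F n in sequentially. norm (ln (1 - c n)) \<le> 2 * c n"
    proof eventually_elim
      case (elim n)
      have "- c n - 2 * (c n)\<^sup>2 \<le> ln (1 - c n)"
        using elim c(1)[of n] by (intro ln_one_minus_pos_lower_bound) auto
      moreover have "2 * (c n)\<^sup>2 \<le> c n"
        using mult_right_mono[of "2 * c n" 1 "c n"] elim c(1)[of n] by (simp add: power2_eq_square)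
      moreover have "ln (1 - c n) \<le> 0"
        using elim c(1)[of n] by simp
      ultimately show ?case
        by simp
    qed
    then have "summable (\<lambda>n. ln (1 - c n))"
      by (rule summable_comparison_test_ev) (intro summable_mult sum_c)
    then have "(\<lambda>N. \<Sum>n<N. ln (1 - c n)) \<longlonglongrightarrow> (\<Sum>n. ln (1 - c n))"
      by (rule summable_LIMSEQ)
    then show False
      using not_tendsto_and_filterlim_at_infinity[OF sequentially_bot]
        filterlim_at_bot_imp_at_infinity[OF ln] unfolding c(2) by blast
  qed
  then have c_top: "filterlim (\<lambda>N. \<Sum>n<N. c n) at_top sequentially"
    unfolding filterlim_at_top eventually_sequentially
  proof (intro allI)
    fix Z
    have "\<not> (\<forall>N. (\<Sum>n<N. c n) \<le> Z)"
      using summableI_nonneg_bounded[of c Z] \<open>\<not> summable c\<close> less_imp_le[OF c(1)] by blast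
    then obtain N where "Z \<le> (\<Sum>n<N. c n)"
      using linear by blast
    moreover have "(\<Sum>n<N. c n) \<le> (\<Sum>n<k. c n)" if "N \<le> k" for k
      using that c(1) by (intro sum_mono2) (auto intro: less_imp_le)
    ultimately show "\<exists>N. \<forall>k\<ge>N. Z \<le> (\<Sum>n<k. c n)"
      by (intro exI[of _ N]) (blast intro: order_trans)
  qed
  \<comment> \<open>After factoring out \<open>exp (x n)\<close>, the bound exp y \<ge> 1 + y is
    used twice: at \<open>- x n\<close>, and at \<open>x n - c n\<close>.\<close>
  have contract: "a (Suc n) \<le> exp (2 * x n - c n) * a n" for n
  proof -
    have "exp (x n) * (2 - c n) - 1 = exp (x n) * (2 - c n - exp (- x n))"
      by (simp add: right_diff_distrib flip: exp_add)
    also have "\<dots> \<le> exp (x n) * exp (x n - c n)"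
      using exp_ge_add_one_self[of "- x n"] exp_ge_add_one_self[of "x n - c n"]
      by (intro mult_left_mono) (linarith, simp)
    also have "\<dots> = exp (2 * x n - c n)"
      by (simp flip: exp_add)
    finally have "(exp (x n) * (2 - c n) - 1) * a n \<le> exp (2 * x n - c n) * a n"
      using nonneg(1) by (rule mult_right_mono)
    then show ?thesis
      using step[of n] unfolding c(2) by (simp add: algebra_simps)
  qed
  have bound: "a n \<le> a 0 * exp (2 * (\<Sum>k<n. x k) - (\<Sum>k<n. c k))" for n
  proof (induction n)
    case (Suc n)
    have "a (Suc n) \<le> exp (2 * x n - c n) * (a 0 * exp (2 * (\<Sum>k<n. x k) - (\<Sum>k<n. c k)))"
      using contract[of n] by (rule order_trans) (intro mult_left_mono Suc.IH exp_ge_zero)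
    also have "\<dots> = a 0 * exp ((2 * x n - c n) + (2 * (\<Sum>k<n. x k) - (\<Sum>k<n. c k)))"
      by (simp only: exp_add ac_simps)
    also have "\<dots> = a 0 * exp (2 * (\<Sum>k<Suc n. x k) - (\<Sum>k<Suc n. c k))"
      by (simp add: algebra_simps)
    finally show ?case .
  qed simp
  have "(\<lambda>n. - 2 * (\<Sum>k<n. x k)) \<longlonglongrightarrow> - 2 * suminf x"
    by (rule tendsto_mult_left[OF summable_LIMSEQ[OF x]])
  then have "filterlim (\<lambda>n. - 2 * (\<Sum>k<n. x k) + (\<Sum>k<n. c k)) at_top sequentially"
    using c_top by (rule filterlim_tendsto_add_at_top)
  moreover have "(\<lambda>n. - 2 * (\<Sum>k<n. x k) + (\<Sum>k<n. c k)) =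
      (\<lambda>n. - (2 * (\<Sum>k<n. x k) - (\<Sum>k<n. c k)))"
    by auto
  ultimately have "filterlim (\<lambda>n. 2 * (\<Sum>k<n. x k) - (\<Sum>k<n. c k)) at_bot sequentially"
    by (simp add: filterlim_uminus_at_bot)
  then have "(\<lambda>n. exp (2 * (\<Sum>k<n. x k) - (\<Sum>k<n. c k))) \<longlonglongrightarrow> 0"
    by (rule filterlim_compose[OF exp_at_bot])
  then have "(\<lambda>n. a 0 * exp (2 * (\<Sum>k<n. x k) - (\<Sum>k<n. c k))) \<longlonglongrightarrow> 0"
    by (rule tendsto_mult_right_zero)
  then show ?thesis
    by (rule Lim_null_comparison[rotated]) (use bound nonneg(1) in simp)
qed

section \<open>Asymptotic stability of the delayed problem\<close>

theorem theorem4p3: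
  fixes A R :: "'h::{real_inner,complete_space} \<Rightarrow> 'h"
    and DA DR :: "'h set"
    and \<iota> :: "'v::{real_inner,complete_space} \<Rightarrow>\<^sub>L 'h"
    and jU :: "'v \<Rightarrow>\<^sub>L 'u1::{real_inner,complete_space}"
    and jW :: "'h \<Rightarrow>\<^sub>L 'w::{real_inner,complete_space}"
    and C \<tau> :: real
    and t :: "nat \<Rightarrow> real"
    and B1 :: "real \<Rightarrow> ('u1 \<Rightarrow>\<^sub>L ('v \<Rightarrow>\<^sub>L real))"
    and B2 :: "real \<Rightarrow> ('u2::{real_inner,complete_space} \<Rightarrow>\<^sub>L 'h)"
    and m M Tbar :: "nat \<Rightarrow> real"
    and d :: "nat \<Rightarrow> real \<Rightarrow> real"
  assumes A: "self_adjoint_op DA A" "positive_op DA A" "has_compact_inverse DA A"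
    and V: "is_sqrt_op DA A DR R" "energy_space DR R \<iota>"
    and jU: "inj (blinfun_apply jU)"
    and jW: "inj (blinfun_apply jW)" "0 < C" "\<forall>v. (norm (jW v))\<^sup>2 \<le> C * (norm v)\<^sup>2"
    and tau: "0 < \<tau>"
    and t: "t 0 = 0" "strict_mono t"
    and B2_zero: "\<forall>n. \<forall>s\<in>slot t (2*n). B2 s = 0"
    and B1_zero: "\<forall>n. \<forall>s\<in>slot t (2*n+1). B1 s = 0"
    and B2_cont: "\<forall>n. C0_closure (t (2*n+1)) (t (2*n+2)) B2"
    and B1_reg: "\<forall>n. C1_into_H \<iota> (t (2*n)) (t (2*n+1)) B1 \<or>
                     sqrt_factor_form (t (2*n)) (t (2*n+1)) B1"
    and const_pos: "\<forall>n. 0 < m (2*n) \<and> m (2*n) \<le> M (2*n) \<and> 0 < M (2*n+1)"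
    and B1_bounds: "\<forall>n. \<forall>s\<in>slot t (2*n). \<forall>v.
            m (2*n) * (norm (jU v))\<^sup>2 \<le> (norm (dual_adjoint (B1 s) v))\<^sup>2 \<and>
            (norm (dual_adjoint (B1 s) v))\<^sup>2 \<le> M (2*n) * (norm (jU v))\<^sup>2"
    and B2_bounds: "\<forall>n. \<forall>s\<in>slot t (2*n+1). \<forall>v.
            (norm (adjoint (blinfun_apply (B2 s)) v))\<^sup>2 \<le> M (2*n+1) * (norm (jW v))\<^sup>2"
    and lengths: "\<forall>n. len t (2*n+1) \<le> \<tau> \<and> \<tau> \<le> len t (2*n)"
    and Tbar: "\<forall>n. Tbar n < len t (2*n)"
    and observability: "\<forall>n. \<forall>L. Tbar n < L \<and> L \<le> len t (2*n) \<longrightarrow>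
            0 < d n L \<and>
            (\<forall>w0 w1 w wt g.
               weak_solution \<iota> B1 (t (2*n)) (t (2*n+1)) w0 w1 w wt \<and>
               damping_trace \<iota> B1 (slot t (2*n)) w wt g \<longrightarrow>
               E_S w wt (t (2*n) + L) \<le>
                 d n L * (LINT s:{t (2*n)..t (2*n) + L}|lebesgue. (norm (g s))\<^sup>2))"
    and sum_delay: "summable (\<lambda>n. M (2*n+1) * len t (2*n+1))"
    and sum_ln: "filterlim (\<lambda>N. \<Sum>n<N. ln (d n (len t (2*n)) / (d n (len t (2*n)) + 1))) at_bot sequentially"
  shows "\<forall>u0 u1 u ut. delayed_solution \<iota> B1 B2 \<tau> t u0 u1 u ut \<longrightarrow>
           ((\<lambda>s. E_S u ut s) \<longlongrightarrow> 0) at_top"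
proof (intro allI impI)
  fix u0 u1 u ut
  assume sol: "delayed_solution \<iota> B1 B2 \<tau> t u0 u1 u ut"
  then have u: "energy_class \<iota> {0..} u ut"
    and even_sol: "\<And>n. limit_of_strong \<iota> B1 (slot t (2*n)) u ut"
    and odd_sol: "\<And>n s. s \<in> slot t (2*n+1) \<Longrightarrow> ((\<lambda>r. pivot \<iota> (ut r)) has_vector_derivative
        - (A_ext (u s) + pivot \<iota> (B2 s (adjoint (blinfun_apply (B2 s)) (ut (s - \<tau>))))))
        (at s within slot t (2*n+1))"
    by (auto simp: delayed_solution_def)
  define E where "E = E_S u ut"
  define a where "a n = E (t (2*n))" for n
  define \<delta> where "\<delta> n = d n (len t (2*n))" for n
  \<comment> \<open>\<open>K n\<close> bounds the squared norm of the adjoint of \<open>B2\<close>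
    as an operator on H, the W-norm being absorbed by \<open>C\<close>; \<open>x n\<close> is the
    Gronwall exponent of one delay interval.\<close>
  define K where "K n = M (2*n+1) * C" for n
  define x where "x n = K n * len t (2*n+1)" for n
  have E_nonneg: "0 \<le> E s" for s
    by (simp add: E_def E_S_def)
  have t_less: "t (2*n) < t (2*n+1)" "t (2*n+1) < t (2*n+2)" for n
    using \<open>strict_mono t\<close> by (auto simp: strict_mono_less)
  have t_nonneg: "0 \<le> t n" for n
    using strict_mono_less_eq[OF \<open>strict_mono t\<close>, of 0 n] t(1) by simp
  have \<delta>: "0 < \<delta> n" for n
    using observability Tbar by (auto simp: \<delta>_def)
  have K: "0 \<le> K n" for n
    using const_pos \<open>0 < C\<close> by (simp add: K_def less_imp_le)
  have x: "0 \<le> x n" for n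
    using K t_less(2)[of n] by (simp add: x_def len_def)
  have sub_class: "energy_class \<iota> {t i..t j} u ut" for i j
  proof -
    have "{t i..t j} \<subseteq> {0..}"
      using t_nonneg[of i] by auto
    then show ?thesis
      using u unfolding energy_class_def
      by (meson continuous_on_subset has_vector_derivative_within_subset subsetD)
  qed
  have even: "E (t (2*n+1)) \<le> \<delta> n / (\<delta> n + 1) * a n"
    "\<And>s. s \<in> {t (2*n)..t (2*n+1)} \<Longrightarrow> E s \<le> a n" for n
  proof -
    have lim: "limit_of_strong \<iota> B1 {t (2*n)..<t (2*n+1)} u ut"
      using even_sol[of n] by (simp add: slot_def)
    have obs: "E_S u ut (t (2*n+1)) \<le> \<delta> n * (LINT s:{t (2*n)..t (2*n+1)}|lebesgue. (norm (g s))\<^sup>2)"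
      if "weak_solution \<iota> B1 (t (2*n)) (t (2*n+1)) (u (t (2*n))) (ut (t (2*n))) u ut"
        and "damping_trace \<iota> B1 {t (2*n)..<t (2*n+1)} u ut g" for g
    proof -
      have "t (2*n) + len t (2*n) = t (2*n+1)"
        by (simp add: len_def)
      \<comment> \<open>Observability is used at the full length of the interval, which
        \<open>Tbar\<close> makes admissible.\<close>
      moreover have "Tbar n < len t (2*n) \<and> len t (2*n) \<le> len t (2*n)"
        using Tbar by simp
      ultimately show ?thesis
        using observability[rule_format, of n "len t (2*n)", THEN conjunct2, rule_format] that
        by (simp add: slot_def \<delta>_def)
    qed
    show "E (t (2*n+1)) \<le> \<delta> n / (\<delta> n + 1) * a n"
      unfolding E_def a_def
      using t_less(1) \<delta> sub_class lim obs by (rule observability_contraction(1))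
    show "E s \<le> a n" if "s \<in> {t (2*n)..t (2*n+1)}" for s
      unfolding E_def a_def
      using t_less(1) \<delta> sub_class lim obs that by (rule observability_contraction(2))
  qed
  have odd: "E s + a n \<le> exp (x n) * (E (t (2*n+1)) + a n)" if s: "s \<in> {t (2*n+1)..t (2*n+2)}" for n s
  proof -
    have "norm (B2 r (adjoint (blinfun_apply (B2 r)) (ut (r - \<tau>)))) \<le> K n * sqrt (2 * a n)"
      if r: "r \<in> {t (2*n+1)..<t (2*n+2)}" for r
    proof -
      have "(norm (adjoint (blinfun_apply (B2 r)) v))\<^sup>2 \<le> K n * (norm v)\<^sup>2" for v
      proof -
        have "(norm (adjoint (blinfun_apply (B2 r)) v))\<^sup>2 \<le> M (2*n+1) * (norm (jW v))\<^sup>2"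
          using B2_bounds r by (simp add: slot_def)
        also have "\<dots> \<le> M (2*n+1) * (C * (norm v)\<^sup>2)"
          using jW(3) const_pos by (intro mult_left_mono) (auto simp: less_imp_le)
        finally show ?thesis
          by (simp add: K_def mult.assoc)
      qed
      then have "norm (B2 r (adjoint (blinfun_apply (B2 r)) (ut (r - \<tau>)))) \<le> K n * norm (ut (r - \<tau>))"
        using K by (rule norm_feedback_le)
      also have "norm (ut (r - \<tau>)) \<le> sqrt (2 * a n)"
      proof (rule real_le_rsqrt)
        \<comment> \<open>\<open>\<tau>\<close> is at least the length of the current interval and
          at most that of the previous one, so the delayed time falls into the preceding damped
          interval.\<close>
        have "r - \<tau> \<in> {t (2*n)..t (2*n+1)}"
          using r lengths[rule_format, of n] by (auto simp: len_def)
        then have "E (r - \<tau>) \<le> a n"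
          by (rule even(2))
        moreover have "(norm (ut (r - \<tau>)))\<^sup>2 \<le> 2 * E (r - \<tau>)"
          by (simp add: E_def E_S_def)
        ultimately show "(norm (ut (r - \<tau>)))\<^sup>2 \<le> 2 * a n"
          by linarith
      qed
      then have "K n * norm (ut (r - \<tau>)) \<le> K n * sqrt (2 * a n)"
        using K by (rule mult_left_mono)
      finally show ?thesis .
    qed
    moreover have "((\<lambda>r. pivot \<iota> (ut r)) has_vector_derivative
        - (A_ext (u r) + pivot \<iota> (B2 r (adjoint (blinfun_apply (B2 r)) (ut (r - \<tau>))))))
        (at r within {t (2*n+1)..<t (2*n+2)})" if "r \<in> {t (2*n+1)..<t (2*n+2)}" for r
      using odd_sol[of r n] that by (simp add: slot_def)
    ultimately have "E s + a n \<le> exp (K n * (s - t (2*n+1))) * (E (t (2*n+1)) + a n)"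
      unfolding E_def using t_less(2) sub_class K E_nonneg s
      by (intro forced_energy_growth) (auto simp: a_def)
    also have "K n * (s - t (2*n+1)) \<le> x n"
      unfolding x_def using s K by (intro mult_left_mono) (auto simp: len_def)
    then have "exp (K n * (s - t (2*n+1))) * (E (t (2*n+1)) + a n) \<le> exp (x n) * (E (t (2*n+1)) + a n)"
      using E_nonneg by (intro mult_right_mono) (auto simp: a_def)
    finally show ?thesis .
  qed
  have sum_x: "summable x"
    using summable_mult[OF sum_delay, of C] by (simp add: x_def[abs_def] K_def ac_simps)
  have "a \<longlonglongrightarrow> 0"
  proof (rule perturbed_contraction_tendsto_0[of a x \<delta>])
    show "a (Suc n) + a n \<le> exp (x n) * (\<delta> n / (\<delta> n + 1) * a n + a n)" for n
    proof -
      have "a (Suc n) + a n \<le> exp (x n) * (E (t (2*n+1)) + a n)"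
        using odd[of "t (2*n+2)" n] t_less(2)[of n] by (simp add: a_def)
      also have "\<dots> \<le> exp (x n) * (\<delta> n / (\<delta> n + 1) * a n + a n)"
        by (intro mult_left_mono add_right_mono even) simp
      finally show ?thesis .
    qed
  qed (use \<delta> x sum_x sum_ln E_nonneg in \<open>simp_all add: a_def \<delta>_def\<close>)
  \<comment> \<open>A bound on the exponents gives one constant for all periods, by which decay at
    the times \<open>t (2*n)\<close> carries over to the times in between.\<close>
  have "Bseq x"
    using summable_LIMSEQ_zero[OF sum_x] by (intro convergent_imp_Bseq convergentI)
  then obtain \<Gamma> where "\<And>n. norm (x n) \<le> \<Gamma>"
    using BseqE by blast
  then have \<Gamma>: "x n \<le> \<Gamma>" for n
    using abs_le_D1[of "x n" \<Gamma>] by simp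
  have \<Gamma>_nonneg: "0 \<le> \<Gamma>"
    using x \<Gamma> order_trans by blast
  have E_le: "E s \<le> 2 * exp \<Gamma> * a n" if s: "s \<in> {t (2*n)..t (2*n+2)}" for n s
  proof (cases "s \<le> t (2*n+1)")
    case True
    then have "E s \<le> 1 * a n"
      using even(2)[of s n] s by simp
    also have "\<dots> \<le> 2 * exp \<Gamma> * a n"
    proof (rule mult_right_mono)
      have "1 \<le> exp \<Gamma>"
        using \<Gamma>_nonneg by simp
      then show "1 \<le> 2 * exp \<Gamma>"
        by linarith
    qed (simp add: a_def E_nonneg)
    finally show ?thesis .
  next
    case False
    have "E s + a n \<le> exp (x n) * (E (t (2*n+1)) + a n)"
      using odd[of s n] s False by simp
    also have "\<dots> \<le> exp \<Gamma> * (a n + a n)"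
      using \<Gamma>[of n] even(2)[of "t (2*n+1)" n] t_less(1)[of n] E_nonneg
      by (intro mult_mono add_mono) (auto simp: a_def)
    finally show ?thesis
      using E_nonneg[of "t (2*n)"] by (simp add: a_def)
  qed
  \<comment> \<open>The lower bound on the damped lengths drives the times to infinity, so that
    every \<open>s\<close> is overtaken.\<close>
  have t_ge: "real n * \<tau> \<le> t (2*n)" for n
  proof (induction n)
    case (Suc n)
    then show ?case
      using lengths[rule_format, of n] t_less(2)[of n] by (simp add: len_def algebra_simps)
  qed (simp add: t(1))
  show "((\<lambda>s. E_S u ut s) \<longlongrightarrow> 0) at_top"
  proof (rule tendstoI)
    fix e :: real
    assume "e > 0"
    have "(\<lambda>n. 2 * exp \<Gamma> * a n) \<longlonglongrightarrow> 2 * exp \<Gamma> * 0"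
      by (intro tendsto_intros \<open>a \<longlonglongrightarrow> 0\<close>)
    then have "\<forall>\<^sub>F n in sequentially. 2 * exp \<Gamma> * a n < e"
      by (rule order_tendstoD) (simp add: \<open>e > 0\<close>)
    then obtain N where N: "\<And>n. N \<le> n \<Longrightarrow> 2 * exp \<Gamma> * a n < e"
      by (auto simp: eventually_sequentially)
    have "dist (E_S u ut s) 0 < e" if s: "t (2*N) \<le> s" for s
    proof -
      obtain k where "s < real k * \<tau>"
        using reals_Archimedean3[OF tau] by blast
      then have "s < t (2*k)"
        using t_ge[of k] by linarith
      \<comment> \<open>The least such index marks the end of the period containing
        \<open>s\<close>; its predecessor is at least \<open>N\<close> because
        \<open>t (2*N) \<le> s\<close>.\<close>
      define l where "l = (LEAST k. s < t (2*k))"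
      have l: "s < t (2*l)"
        unfolding l_def using \<open>s < t (2*k)\<close> by (rule LeastI)
      then have "N < l"
        using s strict_mono_less[OF \<open>strict_mono t\<close>, of "2*N" "2*l"] by simp
      then obtain n where n: "l = Suc n" "N \<le> n"
        by (cases l) auto
      have "t (2*n) \<le> s"
        using not_less_Least[of n "\<lambda>k. s < t (2*k)"] n(1) by (simp add: l_def)
      then have "E s \<le> 2 * exp \<Gamma> * a n"
        using l n(1) by (intro E_le) auto
      then show ?thesis
        using N[OF n(2)] E_nonneg[of s] by (simp add: E_def)
    qed
    then show "\<forall>\<^sub>F s in at_top. dist (E_S u ut s) 0 < e"
      by (auto simp: eventually_at_top_linorder)
  qed
qed

end
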